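(* Let $\mathscr F$ be an admissible space of analytic functions $U\to W$ and fix $z\in U$. For all integers $n,k\ge 1$ the sequence $$0\longrightarrow \mathscr X^{(n)}\xrightarrow{\ \imath_{n,n+k}\ } \mathscr X^{(n+k)}\xrightarrow{\ \pi_{n+k,k}\ } \mathscr X^{(k)}\longrightarrow 0$$ is exact.
   Context: Let $\mathbb D=\{w\in\mathbb C:|w|<1\}$, let $U\subset\mathbb C$ be an open set conformally equivalent to $\mathbb D$, and let $W$ be a complex Banach space. A Banach space $\mathscr F$ of analytic functions $F:U\to W$ is called admissible if: (a) for each $z\in U$ the evaluation map $\delta_z:\mathscr F\to W$, $\delta_z(F)=F(z)$, is bounded; (b) if $\varphi:U\to\mathbb D$ is a conformal equivalence, then an analytic $F:U\to W$ belongs to $\mathscr F$ if and only if $\varphi\cdot F\in\mathscr F$, and in this case $\|\varphi\cdot F\|_{\mathscr F}=\|F\|_{\mathscr F}$. Fix $z\in U$ and write $\widehat f[i;z]=f^{(i)}(z)/i!$. For $n\ge1$, $$\mathscr X^{(n)}=\{(x_{n-1},\dots,x_0)\in W^n:\ \exists f\in\mathscr F,\ x_i=\widehat f[i;z]\text{ for all }0\le i<n\},$$ with norm the infimum of $\|f\|_{\mathscr F}$ over all such $f$; this is a Banach space. For $n,k<m$, $\imath_{n,m}:W^n\to W^m$ is $\imath_{n,m}(x_n,\dots,x_1)=(x_n,\dots,x_1,0,\dots,0)$ and $\pi_{m,k}:W^m\to W^k$ is $\pi_{m,k}(x_m,\dots,x_k,\dots,x_1)=(x_k,\dots,x_1)$.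 The arrows in the sequence are the restrictions of these maps. A sequence of Banach spaces and bounded operators is exact if the kernel of each arrow equals the image of the preceding one. *)

theory Defs
  imports "HOL-Analysis.Analysis"
begin

class complex_banach = banach +
  fixes scaleC :: "complex \<Rightarrow> 'a \<Rightarrow> 'a"  (infixr \<open>*\<^sub>C\<close> 75)
  assumes scaleC_add_right: "c *\<^sub>C (x + y) = c *\<^sub>C x + c *\<^sub>C y"
    and scaleC_add_left: "(c + d) *\<^sub>C x = c *\<^sub>C x + d *\<^sub>C x"
    and scaleC_scaleC: "c *\<^sub>C d *\<^sub>C x = (c * d) *\<^sub>C x"
    and scaleC_of_real: "complex_of_real r *\<^sub>C x = r *\<^sub>R x"
    and norm_scaleC: "norm (c *\<^sub>C x) = cmod c * norm x"

instantiation complex :: complex_banach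
begin

definition scaleC_complex :: "complex \<Rightarrow> complex \<Rightarrow> complex"
  where "scaleC_complex c x = c * x"

instance
  by standard (simp_all add: scaleC_complex_def algebra_simps norm_mult scaleR_conv_of_real)

end

definition conformal_equivalence :: "(complex \<Rightarrow> complex) \<Rightarrow> complex set \<Rightarrow> complex set \<Rightarrow> bool"
  where "conformal_equivalence \<phi> S T \<longleftrightarrow>
    \<phi> holomorphic_on S \<and> bij_betw \<phi> S T \<and> inv_into S \<phi> holomorphic_on T"

text \<open>
  A function \<open>U \<rightarrow> W\<close> is represented by its extension by \<open>0\<close> to the whole plane, so that equality
  of functions on \<open>U\<close> is equality in HOL and pointwise operations stay within such functions.
\<close>

definition analytic_functions :: "complex set \<Rightarrow> (complex \<Rightarrow> 'w::complex_banach) set"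
  where "analytic_functions U = {f. (\<forall>w. w \<notin> U \<longrightarrow> f w = 0) \<and>
    (\<forall>z\<in>U. \<exists>r>0. \<exists>a. \<forall>w\<in>ball z r. (\<lambda>n. (w - z) ^ n *\<^sub>C a n) sums f w)}"

definition cderiv :: "(complex \<Rightarrow> 'w::complex_banach) \<Rightarrow> complex \<Rightarrow> 'w"
  where "cderiv f z = (SOME D. (f has_derivative (\<lambda>h. h *\<^sub>C D)) (at z))"

definition taylor_coeff :: "(complex \<Rightarrow> 'w::complex_banach) \<Rightarrow> nat \<Rightarrow> complex \<Rightarrow> 'w"
  where "taylor_coeff f i z = (1 / fact i) *\<^sub>C (cderiv ^^ i) f z"

text \<open>
  Normed spaces whose elements are families \<open>'i \<Rightarrow> 'w\<close> with pointwise operations, given by a carrier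
  \<open>X\<close> and a norm \<open>N\<close> which is meaningful on \<open>X\<close> only. Both the spaces of analytic functions
  (\<open>'i = complex\<close>) and the spaces of tuples (\<open>'i = nat\<close>) are of this form.
\<close>

definition banach_space_on :: "('i \<Rightarrow> 'w::complex_banach) set \<Rightarrow> (('i \<Rightarrow> 'w) \<Rightarrow> real) \<Rightarrow> bool"
  where "banach_space_on X N \<longleftrightarrow>
    (\<lambda>i. 0) \<in> X \<and>
    (\<forall>x\<in>X. \<forall>y\<in>X. (\<lambda>i. x i + y i) \<in> X) \<and>
    (\<forall>c. \<forall>x\<in>X. (\<lambda>i. c *\<^sub>C x i) \<in> X) \<and>
    (\<forall>x\<in>X. 0 \<le> N x) \<and>
    (\<forall>x\<in>X. N x = 0 \<longleftrightarrow> x = (\<lambda>i. 0)) \<and>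
    (\<forall>c. \<forall>x\<in>X. N (\<lambda>i. c *\<^sub>C x i) = cmod c * N x) \<and>
    (\<forall>x\<in>X. \<forall>y\<in>X. N (\<lambda>i. x i + y i) \<le> N x + N y) \<and>
    (\<forall>s::nat \<Rightarrow> 'i \<Rightarrow> 'w. range s \<subseteq> X \<and>
        (\<forall>e>0. \<exists>M. \<forall>m\<ge>M. \<forall>n\<ge>M. N (\<lambda>i. s m i - s n i) < e) \<longrightarrow>
        (\<exists>x\<in>X. (\<lambda>n. N (\<lambda>i. s n i - x i)) \<longlonglongrightarrow> 0))"

definition bounded_operator_on ::
    "('i \<Rightarrow> 'w::complex_banach) set \<Rightarrow> (('i \<Rightarrow> 'w) \<Rightarrow> real) \<Rightarrow>
     ('j \<Rightarrow> 'v::complex_banach) set \<Rightarrow> (('j \<Rightarrow> 'v) \<Rightarrow> real) \<Rightarrow>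
     (('i \<Rightarrow> 'w) \<Rightarrow> 'j \<Rightarrow> 'v) \<Rightarrow> bool"
  where "bounded_operator_on X N Y M T \<longleftrightarrow>
    (\<forall>x\<in>X. T x \<in> Y) \<and>
    (\<forall>x\<in>X. \<forall>y\<in>X. T (\<lambda>i. x i + y i) = (\<lambda>j. T x j + T y j)) \<and>
    (\<forall>c. \<forall>x\<in>X. T (\<lambda>i. c *\<^sub>C x i) = (\<lambda>j. c *\<^sub>C T x j)) \<and>
    (\<exists>C. \<forall>x\<in>X. M (T x) \<le> C * N x)"

text \<open>Exactness at \<open>Y\<close> of arrows \<open>f\<close> from \<open>X\<close> to \<open>Y\<close> and \<open>g\<close> out of \<open>Y\<close>.\<close>

definition exact_at ::
    "('i \<Rightarrow> 'w::complex_banach) set \<Rightarrow> (('i \<Rightarrow> 'w) \<Rightarrow> 'j \<Rightarrow> 'v::complex_banach) \<Rightarrow>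
     ('j \<Rightarrow> 'v) set \<Rightarrow> (('j \<Rightarrow> 'v) \<Rightarrow> 'k \<Rightarrow> 'u::complex_banach) \<Rightarrow> bool"
  where "exact_at X f Y g \<longleftrightarrow> {y\<in>Y. g y = (\<lambda>k. 0)} = f ` X"

definition short_exact_sequence ::
    "('i \<Rightarrow> 'w::complex_banach) set \<Rightarrow> (('i \<Rightarrow> 'w) \<Rightarrow> real) \<Rightarrow> (('i \<Rightarrow> 'w) \<Rightarrow> 'j \<Rightarrow> 'v) \<Rightarrow>
     ('j \<Rightarrow> 'v::complex_banach) set \<Rightarrow> (('j \<Rightarrow> 'v) \<Rightarrow> real) \<Rightarrow> (('j \<Rightarrow> 'v) \<Rightarrow> 'k \<Rightarrow> 'u) \<Rightarrow>
     ('k \<Rightarrow> 'u::complex_banach) set \<Rightarrow> (('k \<Rightarrow> 'u) \<Rightarrow> real) \<Rightarrow> bool"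
  where "short_exact_sequence X NX f Y NY g Z NZ \<longleftrightarrow>
    banach_space_on X NX \<and> banach_space_on Y NY \<and> banach_space_on Z NZ \<and>
    bounded_operator_on X NX Y NY f \<and> bounded_operator_on Y NY Z NZ g \<and>
    exact_at {\<lambda>i::'i. 0::'w} (\<lambda>x. x) X f \<and>
    exact_at X f Y g \<and>
    exact_at Y g Z (\<lambda>z. \<lambda>k::'k. 0::'u)"

definition admissible ::
    "complex set \<Rightarrow> (complex \<Rightarrow> 'w::complex_banach) set \<Rightarrow> ((complex \<Rightarrow> 'w) \<Rightarrow> real) \<Rightarrow> bool"
  where "admissible U \<F> N \<longleftrightarrow>
    banach_space_on \<F> N \<and> \<F> \<subseteq> analytic_functions U \<and>
    (\<forall>z\<in>U. \<exists>C. \<forall>f\<in>\<F>. norm (f z) \<le> C * N f) \<and>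
    (\<forall>\<phi>. conformal_equivalence \<phi> U (ball 0 1) \<longrightarrow>
      (\<forall>f\<in>analytic_functions U.
        (f \<in> \<F> \<longleftrightarrow> (\<lambda>w. \<phi> w *\<^sub>C f w) \<in> \<F>) \<and>
        (f \<in> \<F> \<longrightarrow> N (\<lambda>w. \<phi> w *\<^sub>C f w) = N f)))"

text \<open>
  A tuple \<open>(x\<^bsub>n-1\<^esub>, \<dots>, x\<^sub>0)\<close> in \<open>W\<^sup>n\<close> is the function mapping \<open>i < n\<close> to \<open>x\<^sub>i\<close> and \<open>i \<ge> n\<close> to \<open>0\<close>;
  the rightmost entry of the tuple has index \<open>0\<close>.
\<close>

definition tuples :: "nat \<Rightarrow> (nat \<Rightarrow> 'w::complex_banach) set"
  where "tuples n = {x. \<forall>i\<ge>n. x i = 0}"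

definition jet_space ::
    "(complex \<Rightarrow> 'w::complex_banach) set \<Rightarrow> complex \<Rightarrow> nat \<Rightarrow> (nat \<Rightarrow> 'w) set"
  where "jet_space \<F> z n = {x \<in> tuples n. \<exists>f\<in>\<F>. \<forall>i<n. x i = taylor_coeff f i z}"

definition jet_norm ::
    "(complex \<Rightarrow> 'w::complex_banach) set \<Rightarrow> ((complex \<Rightarrow> 'w) \<Rightarrow> real) \<Rightarrow> complex \<Rightarrow> nat \<Rightarrow>
     (nat \<Rightarrow> 'w) \<Rightarrow> real"
  where "jet_norm \<F> N z n x = (INF f\<in>{f\<in>\<F>. \<forall>i<n. x i = taylor_coeff f i z}. N f)"

text \<open>
  Since entries are numbered from the right, appending \<open>m - n\<close> zeros on the right shifts the indices,
  and keeping the last \<open>k\<close> entries keeps the indices below \<open>k\<close>.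
\<close>

definition tuple_inj :: "nat \<Rightarrow> nat \<Rightarrow> (nat \<Rightarrow> 'w::complex_banach) \<Rightarrow> nat \<Rightarrow> 'w"
  where "tuple_inj n m x = (\<lambda>i. if i < m - n then 0 else x (i - (m - n)))"

definition tuple_proj :: "nat \<Rightarrow> (nat \<Rightarrow> 'w::complex_banach) \<Rightarrow> nat \<Rightarrow> 'w"
  where "tuple_proj k x = (\<lambda>i. if i < k then x i else 0)"

end

theory Submission
  imports Defs "HOL-Complex_Analysis.Complex_Analysis"
begin

text \<open>
  Compose a conformal equivalence with a disc automorphism to obtain \<open>\<phi>\<close> with \<open>\<phi> z = 0\<close>; being
  injective it has a simple zero there. Two consequences of admissibility then do all the work.

  Division: if \<open>f \<in> \<F>\<close> vanishes at \<open>z\<close>, the quotient of \<open>f\<close> by \<open>\<phi>\<close> is again analytic on \<open>U\<close>, hence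
  lies in \<open>\<F>\<close> with the same norm, and \<open>f\<close> vanishing to order \<open>k\<close> is \<open>\<phi>\<^sup>k h\<close> with \<open>h \<in> \<F>\<close>
  (\<open>divide_by_\<phi>\<close>, \<open>divide_by_\<phi>_power\<close>).

  Multiplication: since \<open>\<phi>\<close> is a local coordinate at \<open>z\<close>, every scalar power series \<open>c\<close> at \<open>z\<close> agrees
  to any finite order with a polynomial in \<open>\<phi>\<close>, and polynomials in \<open>\<phi>\<close> act boundedly on \<open>\<F>\<close>. So the
  \<open>n\<close>-jets of members of \<open>\<F>\<close> form a module over scalar power series, with bounds
  (\<open>jet_multiplier\<close>).

  Appending \<open>k\<close> zeros to a jet on the right is multiplication by \<open>(w - z)\<^sup>k\<close>, so the injection is
  well defined and bounded by the second fact. A jet killed by the projection comes from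
  \<open>f = \<phi>\<^sup>k h\<close>; writing \<open>\<phi> = (w - z) u\<close> its upper entries are the \<open>n\<close>-jet of \<open>u\<^sup>k h\<close>, which is a jet
  from \<open>\<F>\<close>, again by the second fact. This is exactness in the middle (\<open>kernel_tuple_proj\<close>); at the
  two ends exactness is immediate from the formulas for the maps.

  The jet spaces are Banach because they are quotients of \<open>\<F>\<close> (\<open>quotient_banach_space_on\<close>) by the
  subspaces of functions vanishing to order \<open>n\<close> at \<open>z\<close>. That these are closed follows by induction from
  the division step: evaluation at \<open>z\<close> is continuous, and division by \<open>\<phi>\<close> is isometric
  (\<open>vanishing_order_closed\<close>).
\<close>

section \<open>Vector-valued power series\<close>

lemma scaleC_one [simp]: "1 *\<^sub>C (x::'w::complex_banach) = x"
  using scaleC_of_real[of 1 x] by simp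

interpretation scaleC: bounded_bilinear "(*\<^sub>C) :: complex \<Rightarrow> 'w \<Rightarrow> 'w::complex_banach"
proof
  fix a a' r and b b' :: 'w
  show "(a + a') *\<^sub>C b = a *\<^sub>C b + a' *\<^sub>C b" "a *\<^sub>C (b + b') = a *\<^sub>C b + a *\<^sub>C b'"
    by (simp_all add: scaleC_add_left scaleC_add_right)
  show "(r *\<^sub>R a) *\<^sub>C b = r *\<^sub>R a *\<^sub>C b" "a *\<^sub>C r *\<^sub>R b = r *\<^sub>R a *\<^sub>C b"
    by (simp_all add: scaleR_conv_of_real scaleC_scaleC mult.commute flip: scaleC_of_real)
  show "\<exists>K. \<forall>a (b::'w). norm (a *\<^sub>C b) \<le> norm a * norm b * K"
    by (rule exI[of _ 1]) (simp add: norm_scaleC)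
qed

text \<open>
  The radius is a parameter, not quantified away, because termwise differentiation is iterated and
  should not shrink the disc.
\<close>
definition expands_on :: "complex \<Rightarrow> real \<Rightarrow> (complex \<Rightarrow> 'w::complex_banach) \<Rightarrow> (nat \<Rightarrow> 'w) \<Rightarrow> bool"
  where "expands_on z r f a \<longleftrightarrow> (\<forall>w\<in>ball z r. (\<lambda>n. (w - z) ^ n *\<^sub>C a n) sums f w)"

lemma expands_onD: "expands_on z r f a \<Longrightarrow> w \<in> ball z r \<Longrightarrow> (\<lambda>n. (w - z) ^ n *\<^sub>C a n) sums f w"
  by (simp add: expands_on_def)

lemma expands_on_subset: "expands_on z r f a \<Longrightarrow> s \<le> r \<Longrightarrow> expands_on z s f a"
  by (auto simp: expands_on_def)

lemma expands_on_cong: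
  "expands_on z r f a \<Longrightarrow> (\<And>w. w \<in> ball z r \<Longrightarrow> f w = g w) \<Longrightarrow> expands_on z r g a"
  by (auto simp: expands_on_def)

lemma expands_on_add:
  "expands_on z r f a \<Longrightarrow> expands_on z r g b \<Longrightarrow> expands_on z r (\<lambda>w. f w + g w) (\<lambda>n. a n + b n)"
  by (auto simp: expands_on_def scaleC_add_right intro: sums_add)

lemma expands_on_scaleC:
  "expands_on z r f a \<Longrightarrow> expands_on z r (\<lambda>w. c *\<^sub>C f w) (\<lambda>n. c *\<^sub>C a n)"
proof -
  have "(\<lambda>n. u n *\<^sub>C c *\<^sub>C a n) = (\<lambda>n. c *\<^sub>C u n *\<^sub>C a n)" for u
    by (simp add: scaleC_scaleC mult.commute)
  then show "expands_on z r f a \<Longrightarrow> ?thesis"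
    by (auto simp: expands_on_def intro!: bounded_linear.sums[OF scaleC.bounded_linear_right])
qed

lemma expands_on_center: "expands_on z r f a \<Longrightarrow> 0 < r \<Longrightarrow> f z = a 0"
proof -
  assume a: "expands_on z r f a" "0 < r"
  have "(\<lambda>n. (z - z) ^ n *\<^sub>C a n) sums f z"
    using a by (intro expands_onD) auto
  moreover have "(\<lambda>n. (z - z) ^ n *\<^sub>C a n) sums (\<Sum>n\<in>{0}. (z - z) ^ n *\<^sub>C a n)"
    by (rule sums_finite) (auto simp: scaleC.zero_left power_0_left)
  ultimately show ?thesis
    using sums_unique2 by fastforce
qed

text \<open>
  Abel's lemma: convergence at distance \<open>s > t\<close> from \<open>z\<close> bounds the terms there, so the terms at
  distance \<open>t\<close> are dominated by a geometric series.
\<close>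
lemma expands_on_summable_norm:
  assumes f: "expands_on z r f a" and t: "0 \<le> t" "t < r"
  shows "summable (\<lambda>n. norm (a n) * t ^ n)"
proof -
  obtain s where s: "t < s" "s < r" using t dense by blast
  have "z + of_real s \<in> ball z r" using s t by (simp add: dist_norm)
  from expands_onD[OF f this] have "summable (\<lambda>n. of_real s ^ n *\<^sub>C a n)"
    by (simp add: sums_iff)
  then have "Bseq (\<lambda>n. complex_of_real s ^ n *\<^sub>C a n)"
    by (meson summable_LIMSEQ_zero convergentI convergent_imp_Bseq)
  then obtain K where K: "norm (complex_of_real s ^ n *\<^sub>C a n) \<le> K" for n
    unfolding Bseq_def by blast
  then have "norm (a n) * s ^ n \<le> K" for n
    using K[of n] s t by (simp add: norm_scaleC norm_power mult.commute)
  then show ?thesis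
    using Abel_lemma[OF t(1) s(1)] by blast
qed

lemma expands_on_summable_terms:
  assumes f: "expands_on z r f a" and w: "w \<in> ball z r"
  shows "summable (\<lambda>n. norm ((w - z) ^ n *\<^sub>C a n))"
proof -
  have "summable (\<lambda>n. norm (a n) * norm (w - z) ^ n)"
    using w by (intro expands_on_summable_norm[OF f]) (auto simp: dist_norm norm_minus_commute)
  then show ?thesis by (simp add: norm_scaleC norm_power mult.commute)
qed

lemma scaleC_has_derivative_unique:
  fixes D :: "'w::complex_banach"
  assumes "(f has_derivative (\<lambda>h. h *\<^sub>C D)) (at z)"
  shows "cderiv f z = D"
proof -
  have "(f has_derivative (\<lambda>h. h *\<^sub>C cderiv f z)) (at z)"
    unfolding cderiv_def by (rule someI) (rule assms)
  then have "(\<lambda>h. h *\<^sub>C cderiv f z) = (\<lambda>h. h *\<^sub>C D)"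
    using assms has_derivative_unique by blast
  then have "1 *\<^sub>C cderiv f z = 1 *\<^sub>C D" by metis
  then show ?thesis by simp
qed

text \<open>
  Termwise differentiation. On a slightly smaller disc of radius \<open>t\<close> the differentiated series is
  dominated by the series \<open>M\<close> of real numbers, which converges because it is the formal derivative of
  \<open>\<Sum>\<parallel>a\<^sub>n\<parallel> t\<^sup>n\<close>; so it converges uniformly.
\<close>
lemma expands_on_cderiv:
  fixes f :: "complex \<Rightarrow> 'w::complex_banach"
  assumes f: "expands_on z r f a"
  shows "expands_on z r (cderiv f) (\<lambda>n. of_nat (Suc n) *\<^sub>C a (Suc n))"
  unfolding expands_on_def
proof
  fix w assume w: "w \<in> ball z r"
  then have "norm (w - z) < r" by (simp add: dist_norm norm_minus_commute)
  then obtain t where t: "norm (w - z) < t" "t < r" using dense by blast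
  then have t0: "0 < t" by (metis norm_ge_zero order_le_less_trans)
  define S where "S = ball z t"
  define d where "d = (\<lambda>n x. (of_nat n * (x - z) ^ (n - 1)) *\<^sub>C a n)"
  define M where "M = (\<lambda>n. real n * t ^ (n - 1) * norm (a n))"
  have wS: "w \<in> S" using t by (simp add: S_def dist_norm norm_minus_commute)
  have Ssub: "S \<subseteq> ball z r" using t by (auto simp: S_def)
  have sumM: "summable M"
  proof -
    have "summable (\<lambda>n. diffs (\<lambda>n. norm (a n)) n * t ^ n)"
    proof (rule termdiff_converges)
      show "norm t < r" using t t0 by simp
      fix x :: real assume "norm x < r"
      then have "summable (\<lambda>n. norm (norm (a n) * x ^ n))"
        using expands_on_summable_norm[OF f, of "\<bar>x\<bar>"] by (simp add: abs_mult power_abs)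
      then show "summable (\<lambda>n. norm (a n) * x ^ n)"
        by (rule summable_norm_cancel)
    qed
    then have "summable (\<lambda>n. M (Suc n))"
      by (simp add: M_def diffs_def mult_ac)
    then show ?thesis by (simp add: summable_Suc_iff)
  qed
  have dM: "norm (d n x) \<le> M n" if "x \<in> S" for n x
  proof -
    have "norm (x - z) ^ (n - 1) \<le> t ^ (n - 1)"
      using that by (intro power_mono) (auto simp: S_def dist_norm norm_minus_commute)
    then show ?thesis
      by (simp add: d_def M_def norm_scaleC norm_mult norm_power mult_left_mono mult_right_mono)
  qed
  have unif: "uniform_limit S (\<lambda>n x. \<Sum>i<n. d i x) (\<lambda>x. suminf (\<lambda>i. d i x)) sequentially"
    using dM sumM by (rule Weierstrass_m_test)
  have der: "((\<lambda>x. (x - z) ^ n *\<^sub>C a n) has_derivative (\<lambda>h. h *\<^sub>C d n x)) (at x within S)" for n x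
  proof -
    have "((\<lambda>x. (x - z) ^ n *\<^sub>C a n) has_derivative
        (\<lambda>h. (of_nat n * (h - 0) * (x - z) ^ (n - 1)) *\<^sub>C a n)) (at x within S)"
      by (intro scaleC.bounded_linear_left[THEN bounded_linear.has_derivative] has_derivative_power
            derivative_intros)
    then show ?thesis by (simp add: d_def scaleC_scaleC mult_ac)
  qed
  have "\<exists>g. \<forall>x\<in>S. (\<lambda>n. (x - z) ^ n *\<^sub>C a n) sums g x \<and>
      (g has_derivative (\<lambda>h. h *\<^sub>C (suminf (\<lambda>i. d i x)))) (at x within S)"
  proof (rule has_derivative_series)
    show "convex S" by (simp add: S_def)
    show "((\<lambda>x. (x - z) ^ n *\<^sub>C a n) has_derivative (\<lambda>h. h *\<^sub>C d n x)) (at x within S)" for n x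
      by (rule der)
    show "w \<in> S" by (rule wS)
    show "(\<lambda>n. (w - z) ^ n *\<^sub>C a n) sums f w" using f w by (simp add: expands_on_def)
    fix e :: real assume "0 < e"
    with unif have "\<forall>\<^sub>F n in sequentially. \<forall>x\<in>S. dist (\<Sum>i<n. d i x) (suminf (\<lambda>i. d i x)) < e"
      by (simp add: uniform_limit_iff)
    then show "\<forall>\<^sub>F n in sequentially. \<forall>x\<in>S. \<forall>h.
        norm ((\<Sum>i<n. h *\<^sub>C d i x) - h *\<^sub>C (suminf (\<lambda>i. d i x))) \<le> e * norm h"
    proof eventually_elim
      case (elim n)
      show ?case
      proof (intro ballI allI)
        fix x h assume x: "x \<in> S"
        have "(\<Sum>i<n. h *\<^sub>C d i x) - h *\<^sub>C (suminf (\<lambda>i. d i x))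
            = h *\<^sub>C ((\<Sum>i<n. d i x) - suminf (\<lambda>i. d i x))"
          by (simp add: scaleC.sum_right scaleC.diff_right)
        then show "norm ((\<Sum>i<n. h *\<^sub>C d i x) - h *\<^sub>C (suminf (\<lambda>i. d i x))) \<le> e * norm h"
          using elim x
            by (auto simp: norm_scaleC dist_norm mult.commute[of e] intro!: mult_left_mono dest: less_imp_le)
      qed
    qed
  qed
  then obtain g where g: "\<And>x. x \<in> S \<Longrightarrow> (\<lambda>n. (x - z) ^ n *\<^sub>C a n) sums g x"
      "\<And>x. x \<in> S \<Longrightarrow> (g has_derivative (\<lambda>h. h *\<^sub>C (suminf (\<lambda>i. d i x)))) (at x within S)"
    by blast
  have gf: "g x = f x" if "x \<in> S" for x
    using g(1)[OF that] expands_onD[OF f, of x] that Ssub sums_unique2 by blast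
  have "(f has_derivative (\<lambda>h. h *\<^sub>C (suminf (\<lambda>i. d i w)))) (at w within S)"
    using g(2)[OF wS] gf wS by (metis has_derivative_transform)
  then have "(f has_derivative (\<lambda>h. h *\<^sub>C (suminf (\<lambda>i. d i w)))) (at w)"
    using at_within_open[OF wS] by (simp add: S_def)
  then have "cderiv f w = suminf (\<lambda>i. d i w)"
    by (rule scaleC_has_derivative_unique)
  moreover have "summable (\<lambda>i. d i w)"
    by (rule summable_comparison_test'[OF sumM, of 0]) (rule dM[OF wS])
  ultimately have "(\<lambda>i. d i w) sums cderiv f w" by (simp add: sums_iff)
  then have "(\<lambda>i. d (Suc i) w) sums cderiv f w"
    by (subst sums_Suc_iff) (simp add: d_def scaleC.zero_left)
  then show "(\<lambda>n. (w - z) ^ n *\<^sub>C of_nat (Suc n) *\<^sub>C a (Suc n)) sums cderiv f w"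
    by (simp add: d_def scaleC_scaleC mult.commute)
qed

lemma expands_on_cderiv_funpow:
  assumes "expands_on z r f a"
  shows "expands_on z r ((cderiv ^^ i) f) (\<lambda>n. (fact (n + i) / fact n) *\<^sub>C a (n + i))"
proof (induction i)
  case 0
  show ?case using assms by simp
next
  case (Suc i)
  have "of_nat (Suc n) * (fact (Suc n + i) / fact (Suc n)) = (fact (n + Suc i) / fact n :: complex)" for n
    by (simp add: field_simps del: of_nat_Suc)
  then have "(\<lambda>n. of_nat (Suc n) *\<^sub>C (fact (Suc n + i) / fact (Suc n)) *\<^sub>C a (Suc n + i))
      = (\<lambda>n. (fact (n + Suc i) / fact n) *\<^sub>C a (n + Suc i))"
    by (simp add: scaleC_scaleC del: of_nat_Suc fact_Suc)
  with expands_on_cderiv[OF Suc.IH] show ?case by simp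
qed

text \<open>
  Any local expansion has the Taylor coefficients as its coefficients; in particular expansions are
  unique, and identities of Taylor coefficients can be read off from expansions.
\<close>
lemma taylor_coeff_expands_on:
  assumes "expands_on z r f a" "0 < r"
  shows "taylor_coeff f i z = a i"
  using expands_on_center[OF expands_on_cderiv_funpow[OF assms(1)] assms(2), of i]
  by (simp add: taylor_coeff_def scaleC_scaleC)

text \<open>
  The difference between the product of the \<open>n\<close>-th partial sums and the \<open>n\<close>-th partial sum of the
  Cauchy product is the sum over the square \<open>A n\<close> outside the triangle \<open>T n\<close>. It is dominated by the
  corresponding difference for the norms, which tends to \<open>0\<close> by the Cauchy product theorem for real
  series.
\<close>
lemma Cauchy_product_sums_scaleC:
  fixes q :: "nat \<Rightarrow> 'w::complex_banach"
  assumes p: "summable (\<lambda>k. norm (p k))" and q: "summable (\<lambda>k. norm (q k))"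
  shows "(\<lambda>k. \<Sum>i\<le>k. p i *\<^sub>C q (k - i)) sums (suminf p *\<^sub>C suminf q)"
proof -
  define A where "A = (\<lambda>n::nat. {..<n} \<times> {..<n})"
  define T where "T = (\<lambda>n::nat. {(i, j). i + j < n})"
  have TA: "T n \<subseteq> A n" and finA: "finite (A n)" for n
    by (auto simp: A_def T_def)
  have decomp: "(\<Sum>i<n. p i) *\<^sub>C (\<Sum>j<n. q j) - (\<Sum>k<n. \<Sum>i\<le>k. p i *\<^sub>C q (k - i))
      = (\<Sum>(i, j)\<in>A n - T n. p i *\<^sub>C q j)" for n
  proof -
    have "(\<Sum>i<n. p i) *\<^sub>C (\<Sum>j<n. q j) = (\<Sum>(i, j)\<in>A n. p i *\<^sub>C q j)"
      unfolding A_def scaleC.sum_left unfolding scaleC.sum_right by (rule sum.cartesian_product)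
    then show ?thesis
      unfolding sum_diff[OF finA TA] unfolding T_def
      by (simp add: sum.triangle_reindex)
  qed
  have decomp_norm: "(\<Sum>i<n. norm (p i)) * (\<Sum>j<n. norm (q j))
        - (\<Sum>k<n. \<Sum>i\<le>k. norm (p i) * norm (q (k - i)))
      = (\<Sum>(i, j)\<in>A n - T n. norm (p i) * norm (q j))" for n
  proof -
    have "(\<Sum>i<n. norm (p i)) * (\<Sum>j<n. norm (q j)) = (\<Sum>(i, j)\<in>A n. norm (p i) * norm (q j))"
      by (simp add: A_def sum_product sum.cartesian_product)
    then show ?thesis
      unfolding sum_diff[OF finA TA] unfolding T_def
      by (simp add: sum.triangle_reindex)
  qed
  have "(\<lambda>n. (\<Sum>i<n. norm (p i)) * (\<Sum>j<n. norm (q j))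
        - (\<Sum>k<n. \<Sum>i\<le>k. norm (p i) * norm (q (k - i))))
      \<longlonglongrightarrow> (\<Sum>i. norm (p i)) * (\<Sum>j. norm (q j)) - (\<Sum>i. norm (p i)) * (\<Sum>j. norm (q j))"
    using Cauchy_product_sums[of "\<lambda>i. norm (p i)" "\<lambda>i. norm (q i)"] p q
    by (intro tendsto_intros summable_LIMSEQ) (simp_all add: sums_def)
  then have "(\<lambda>n. \<Sum>(i, j)\<in>A n - T n. norm (p i) * norm (q j)) \<longlonglongrightarrow> 0"
    by (simp add: decomp_norm)
  then have "(\<lambda>n. \<Sum>(i, j)\<in>A n - T n. p i *\<^sub>C q j) \<longlonglongrightarrow> 0"
    by (rule Lim_null_comparison[rotated])
       (auto intro!: always_eventually sum_norm_le simp: norm_scaleC)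
  moreover have "(\<lambda>n. (\<Sum>i<n. p i) *\<^sub>C (\<Sum>j<n. q j)) \<longlonglongrightarrow> suminf p *\<^sub>C suminf q"
    using p q by (intro scaleC.tendsto summable_LIMSEQ) (auto intro: summable_norm_cancel)
  ultimately have "(\<lambda>n. (\<Sum>i<n. p i) *\<^sub>C (\<Sum>j<n. q j) - (\<Sum>(i, j)\<in>A n - T n. p i *\<^sub>C q j))
      \<longlonglongrightarrow> suminf p *\<^sub>C suminf q - 0"
    by (rule tendsto_diff[rotated])
  then show ?thesis
    by (simp add: sums_def flip: decomp)
qed

text \<open>
  Convolution makes the coefficient sequences of \<open>W\<close>-valued series a module over scalar formal power
  series; this module structure replaces manipulation of the functions themselves.
\<close>
definition fps_act :: "complex fps \<Rightarrow> (nat \<Rightarrow> 'w::complex_banach) \<Rightarrow> nat \<Rightarrow> 'w"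
  where "fps_act c a n = (\<Sum>i\<le>n. fps_nth c i *\<^sub>C a (n - i))"

lemma fps_act_mult: "fps_act (b * c) a = fps_act b (fps_act c a)"
proof
  fix n
  have "fps_act (b * c) a n
      = (\<Sum>k\<le>n. \<Sum>i\<le>k. (fps_nth b i * fps_nth c (k - i)) *\<^sub>C a (n - (i + (k - i))))"
    by (simp add: fps_act_def fps_mult_nth atLeast0AtMost scaleC.sum_left)
  also have "\<dots> = (\<Sum>(i, j)\<in>{(i, j). i + j \<le> n}. (fps_nth b i * fps_nth c j) *\<^sub>C a (n - (i + j)))"
    by (rule sum.triangle_reindex_eq[symmetric])
  also have "{(i, j). i + j \<le> n} = Sigma {..n} (\<lambda>i. {..n - i})"
    by auto
  also have "(\<Sum>(i, j)\<in>\<dots>. (fps_nth b i * fps_nth c j) *\<^sub>C a (n - (i + j)))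
      = fps_act b (fps_act c a) n"
    by (simp add: fps_act_def scaleC.sum_right scaleC_scaleC flip: sum.Sigma)
  finally show "fps_act (b * c) a n = fps_act b (fps_act c a) n" .
qed

lemma fps_act_const: "fps_act (fps_const c) a = (\<lambda>n. c *\<^sub>C a n)"
proof
  fix n
  have "fps_act (fps_const c) a n = (\<Sum>i\<le>n. if i = 0 then c *\<^sub>C a n else 0)"
    unfolding fps_act_def by (rule sum.cong) (auto simp: scaleC.zero_left)
  then show "fps_act (fps_const c) a n = c *\<^sub>C a n" by simp
qed

lemma fps_act_add_left: "fps_act (b + c) a n = fps_act b a n + fps_act c a n"
  by (simp add: fps_act_def scaleC_add_left sum.distrib)

lemma fps_act_X_power: "fps_act (fps_X ^ k) a n = (if n < k then 0 else a (n - k))"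
proof -
  have "fps_act (fps_X ^ k) a n = (\<Sum>i\<le>n. if i = k then a (n - k) else 0)"
    unfolding fps_act_def by (rule sum.cong) (auto simp: scaleC.zero_left)
  then show ?thesis by (simp add: not_less)
qed

lemma fps_act_X_Suc: "fps_act fps_X a (Suc n) = a n"
  using fps_act_X_power[of 1 a "Suc n"] by simp

lemma fps_act_cong: "(\<And>i. i \<le> n \<Longrightarrow> a i = b i) \<Longrightarrow> fps_act c a n = fps_act c b n"
  by (simp add: fps_act_def)

lemma expands_on_scaleC_product:
  assumes p: "expands_on z r p (fps_nth c)" and f: "expands_on z r f a"
  shows "expands_on z r (\<lambda>w. p w *\<^sub>C f w) (fps_act c a)"
  unfolding expands_on_def
proof
  fix w assume w: "w \<in> ball z r"
  have "(\<lambda>k. \<Sum>i\<le>k. ((w - z) ^ i *\<^sub>C fps_nth c i) *\<^sub>C (w - z) ^ (k - i) *\<^sub>C a (k - i)) sums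
      ((\<Sum>i. (w - z) ^ i *\<^sub>C fps_nth c i) *\<^sub>C (\<Sum>i. (w - z) ^ i *\<^sub>C a i))"
    by (rule Cauchy_product_sums_scaleC) (rule expands_on_summable_terms[OF p w] expands_on_summable_terms[OF f w])+
  moreover have "(\<Sum>i\<le>k. ((w - z) ^ i *\<^sub>C fps_nth c i) *\<^sub>C (w - z) ^ (k - i) *\<^sub>C a (k - i))
      = (w - z) ^ k *\<^sub>C fps_act c a k" for k
    unfolding fps_act_def scaleC.sum_right
  proof (rule sum.cong)
    fix i assume "i \<in> {..k}"
    then have "(w - z) ^ k = (w - z) ^ i * (w - z) ^ (k - i)" by (simp flip: power_add)
    then show "((w - z) ^ i *\<^sub>C fps_nth c i) *\<^sub>C (w - z) ^ (k - i) *\<^sub>C a (k - i)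
        = (w - z) ^ k *\<^sub>C fps_nth c i *\<^sub>C a (k - i)"
      by (simp add: scaleC_scaleC scaleC_complex_def mult_ac)
  qed simp
  ultimately show "(\<lambda>k. (w - z) ^ k *\<^sub>C fps_act c a k) sums (p w *\<^sub>C f w)"
    using expands_onD[OF p w] expands_onD[OF f w] by (simp add: sums_iff)
qed

lemma holomorphic_expands_on:
  assumes "p holomorphic_on ball z r"
  shows "expands_on z r p (fps_nth (fps_expansion p z))"
  using holomorphic_power_series[OF assms]
  by (simp add: expands_on_def fps_expansion_def scaleC_complex_def mult.commute)

text \<open>At \<open>w = z\<close> the quotient takes its limit value, the linear coefficient of \<open>f\<close>.\<close>
lemma expands_on_divide_linear:
  assumes f: "expands_on z r f a" and "f z = 0" "0 < r"
  shows "expands_on z r (\<lambda>w. if w = z then a 1 else inverse (w - z) *\<^sub>C f w) (\<lambda>n. a (Suc n))"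
  unfolding expands_on_def
proof
  fix w assume w: "w \<in> ball z r"
  have a0: "a 0 = 0" using expands_on_center[OF f] assms by simp
  show "(\<lambda>n. (w - z) ^ n *\<^sub>C a (Suc n)) sums (if w = z then a 1 else inverse (w - z) *\<^sub>C f w)"
  proof (cases "w = z")
    case True
    have "(\<lambda>n. (z - z) ^ n *\<^sub>C a (Suc n)) sums (\<Sum>n\<in>{0}. (z - z) ^ n *\<^sub>C a (Suc n))"
      by (rule sums_finite) (auto simp: scaleC.zero_left power_0_left)
    with True show ?thesis by simp
  next
    case False
    have "(\<lambda>n. (w - z) ^ Suc n *\<^sub>C a (Suc n)) sums f w"
      using expands_onD[OF f w] by (subst sums_Suc_iff) (simp add: a0)
    then have "(\<lambda>n. inverse (w - z) *\<^sub>C (w - z) ^ Suc n *\<^sub>C a (Suc n)) sums (inverse (w - z) *\<^sub>C f w)"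
      by (rule bounded_linear.sums[OF scaleC.bounded_linear_right])
    with False show ?thesis by (simp add: scaleC_scaleC flip: mult.assoc)
  qed
qed

section \<open>Quotients of Banach spaces by closed subspaces\<close>

lemma banach_space_onD:
  assumes "banach_space_on X N"
  shows banach_zero: "(\<lambda>i. 0) \<in> X"
    and banach_add: "\<And>x y. x \<in> X \<Longrightarrow> y \<in> X \<Longrightarrow> (\<lambda>i. x i + y i) \<in> X"
    and banach_scaleC: "\<And>c x. x \<in> X \<Longrightarrow> (\<lambda>i. c *\<^sub>C x i) \<in> X"
    and banach_nonneg: "\<And>x. x \<in> X \<Longrightarrow> 0 \<le> N x"
    and banach_norm_eq_0: "\<And>x. x \<in> X \<Longrightarrow> N x = 0 \<longleftrightarrow> x = (\<lambda>i. 0)"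
    and banach_norm_scaleC: "\<And>c x. x \<in> X \<Longrightarrow> N (\<lambda>i. c *\<^sub>C x i) = cmod c * N x"
    and banach_triangle: "\<And>x y. x \<in> X \<Longrightarrow> y \<in> X \<Longrightarrow> N (\<lambda>i. x i + y i) \<le> N x + N y"
    and banach_complete: "\<And>s :: nat \<Rightarrow> _. (\<And>m. s m \<in> X) \<Longrightarrow>
        (\<And>e. 0 < e \<Longrightarrow> \<exists>M. \<forall>m\<ge>M. \<forall>n\<ge>M. N (\<lambda>i. s m i - s n i) < e) \<Longrightarrow>
        \<exists>x\<in>X. (\<lambda>n. N (\<lambda>i. s n i - x i)) \<longlonglongrightarrow> 0"
  using assms unfolding banach_space_on_def by (simp_all add: image_subset_iff)

lemma scaleC_minus_one: "- 1 *\<^sub>C (x::'w::complex_banach) = - x"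
  by (simp add: scaleC.minus_left)

lemma banach_diff:
  assumes "banach_space_on X N" "x \<in> X" "y \<in> X"
  shows "(\<lambda>i. x i - y i) \<in> X"
  using banach_add[OF assms(1,2) banach_scaleC[OF assms(1,3), of "- 1"]]
  by (simp add: scaleC_minus_one)

lemma banach_norm_minus_commute:
  assumes "banach_space_on X N" "x \<in> X" "y \<in> X"
  shows "N (\<lambda>i. x i - y i) = N (\<lambda>i. y i - x i)"
  using banach_norm_scaleC[OF assms(1) banach_diff[OF assms(1,3,2)], of "- 1"]
  by (simp add: scaleC_minus_one)

lemma banach_triangle_diff:
  assumes "banach_space_on X N" "x \<in> X" "y \<in> X" "u \<in> X"
  shows "N (\<lambda>i. x i - u i) \<le> N (\<lambda>i. x i - y i) + N (\<lambda>i. y i - u i)"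
  using banach_triangle[OF assms(1) banach_diff[OF assms(1,2,3)] banach_diff[OF assms(1,3,4)]]
  by simp

lemma banach_norm_zero:
  assumes "banach_space_on X N"
  shows "N (\<lambda>i. 0) = 0"
  using banach_norm_eq_0[OF assms banach_zero[OF assms]] by simp

text \<open>Telescoping turns geometrically small steps into the Cauchy condition.\<close>
lemma banach_complete_geometric:
  assumes X: "banach_space_on X N" and s: "\<And>m::nat. s m \<in> X"
    and step: "\<And>m. N (\<lambda>i. s (Suc m) i - s m i) \<le> (1/2) ^ m"
  shows "\<exists>x\<in>X. (\<lambda>n. N (\<lambda>i. s n i - x i)) \<longlonglongrightarrow> 0"
proof (rule banach_complete[OF X s])
  have tail: "N (\<lambda>i. s (m + p) i - s m i) \<le> 2 * (1/2) ^ m - 2 * (1/2) ^ (m + p)" for m p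
  proof (induction p)
    case 0
    then show ?case using banach_norm_zero[OF X] by simp
  next
    case (Suc p)
    have "N (\<lambda>i. s (Suc (m + p)) i - s m i)
        \<le> N (\<lambda>i. s (Suc (m + p)) i - s (m + p) i) + N (\<lambda>i. s (m + p) i - s m i)"
      by (rule banach_triangle_diff[OF X s s s])
    with Suc step[of "m + p"] show ?case by simp
  qed
  fix e :: real assume "0 < e"
  then obtain M :: nat where M: "(1/2) ^ M < e / 4"
    using real_arch_pow_inv[of "e/4" "1/2"] by auto
  have near: "N (\<lambda>i. s m i - s M i) < e / 2" if "M \<le> m" for m
  proof -
    have "N (\<lambda>i. s (M + (m - M)) i - s M i) \<le> 2 * (1/2) ^ M - 2 * (1/2) ^ (M + (m - M))"
      by (rule tail)
    moreover have "0 < (1/2::real) ^ (M + (m - M))" by simp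
    ultimately have "N (\<lambda>i. s (M + (m - M)) i - s M i) < e / 2" using M by linarith
    then show ?thesis using that by simp
  qed
  show "\<exists>M. \<forall>m\<ge>M. \<forall>n\<ge>M. N (\<lambda>i. s m i - s n i) < e"
  proof (intro exI allI impI)
    fix m n assume mn: "M \<le> m" "M \<le> n"
    have "N (\<lambda>i. s m i - s n i) \<le> N (\<lambda>i. s m i - s M i) + N (\<lambda>i. s M i - s n i)"
      by (rule banach_triangle_diff[OF X s s s])
    then show "N (\<lambda>i. s m i - s n i) < e"
      using near[OF mn(1)] near[OF mn(2)] banach_norm_minus_commute[OF X s s, of M n] by simp
  qed
qed

text \<open>
  The image of \<open>J\<close>, with the infimum of \<open>N\<close> over fibres as norm, is the quotient of \<open>X\<close> by the kernel.
  Closedness of the kernel makes the seminorm \<open>Q\<close> definite. For completeness a Cauchy sequence is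
  thinned out so that consecutive differences have \<open>Q\<close> below \<open>2\<^sup>-\<^sup>k\<close>; these differences are lifted to
  \<open>X\<close> with norm below \<open>2\<^sup>-\<^sup>k\<close>, and the partial sums of the lifts converge in \<open>X\<close>.
\<close>
lemma quotient_banach_space_on:
  fixes J :: "('i \<Rightarrow> 'w::complex_banach) \<Rightarrow> 'j \<Rightarrow> 'v::complex_banach"
  assumes X: "banach_space_on X N"
    and J_add: "\<And>x y. x \<in> X \<Longrightarrow> y \<in> X \<Longrightarrow> J (\<lambda>i. x i + y i) = (\<lambda>j. J x j + J y j)"
    and J_scaleC: "\<And>c x. x \<in> X \<Longrightarrow> J (\<lambda>i. c *\<^sub>C x i) = (\<lambda>j. c *\<^sub>C J x j)"
    and closed: "\<And>(s :: nat \<Rightarrow> _) x. (\<And>m. s m \<in> X) \<Longrightarrow> (\<And>m. J (s m) = (\<lambda>j. 0)) \<Longrightarrow> x \<in> X \<Longrightarrow>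
        (\<lambda>m. N (\<lambda>i. s m i - x i)) \<longlonglongrightarrow> 0 \<Longrightarrow> J x = (\<lambda>j. 0)"
    and Q: "\<And>y. y \<in> J ` X \<Longrightarrow> Q y = (INF x\<in>{x\<in>X. J x = y}. N x)"
  shows "banach_space_on (J ` X) Q"
proof -
  have J_diff: "J (\<lambda>i. x i - y i) = (\<lambda>j. J x j - J y j)" if "x \<in> X" "y \<in> X" for x y
    using J_add[OF that(1) banach_scaleC[OF X that(2), of "- 1"]] J_scaleC[OF that(2), of "- 1"]
    by (simp add: scaleC_minus_one)
  have J_zero: "J (\<lambda>i. 0) = (\<lambda>j. 0)"
    using J_scaleC[OF banach_zero[OF X], of 0] by (simp add: scaleC.zero_left)
  have Q_le: "Q (J x) \<le> N x" if "x \<in> X" for x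
    unfolding Q[OF imageI[OF that]]
    by (rule cINF_lower) (use that banach_nonneg[OF X] in \<open>auto intro!: bdd_belowI2\<close>)
  have Q_greatest: "b \<le> Q y" if "y \<in> J ` X" "\<And>x. x \<in> X \<Longrightarrow> J x = y \<Longrightarrow> b \<le> N x" for b y
    unfolding Q[OF that(1)] by (rule cINF_greatest) (use that in auto)
  have lift: "\<exists>x\<in>X. J x = y \<and> N x < b" if "y \<in> J ` X" "Q y < b" for b y
    using Q_greatest[OF that(1), of b] that(2) by force
  have Q_nonneg: "0 \<le> Q y" if "y \<in> J ` X" for y
    using that banach_nonneg[OF X] by (intro Q_greatest)
  have Q_scaleC_le: "Q (\<lambda>j. c *\<^sub>C y j) \<le> cmod c * Q y" if y: "y \<in> J ` X" for c y
  proof (rule field_le_epsilon)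
    fix e :: real assume e: "0 < e"
    define e' where "e' = e / (cmod c + 1)"
    have "0 < cmod c + 1" using norm_ge_zero[of c] by linarith
    then have e': "0 < e'" "cmod c * e' \<le> e"
      using e by (simp_all add: e'_def divide_le_eq distrib_left mult.commute)
    then obtain x where x: "x \<in> X" "J x = y" "N x < Q y + e'"
      using lift[OF y, of "Q y + e'"] by auto
    have "Q (\<lambda>j. c *\<^sub>C y j) \<le> cmod c * N x"
      using Q_le[OF banach_scaleC[OF X x(1), of c]] x banach_norm_scaleC[OF X x(1), of c]
        J_scaleC[OF x(1), of c] by simp
    also have "\<dots> \<le> cmod c * (Q y + e')"
      using x by (intro mult_left_mono) auto
    finally show "Q (\<lambda>j. c *\<^sub>C y j) \<le> cmod c * Q y + e"
      using e' by (simp add: distrib_left)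
  qed
  have scaleC_mem: "(\<lambda>j. c *\<^sub>C y j) \<in> J ` X" if "y \<in> J ` X" for c y
    using that by (auto intro!: banach_scaleC[OF X] imageI simp flip: J_scaleC)
  have add_mem: "(\<lambda>j. x j + y j) \<in> J ` X" if "x \<in> J ` X" "y \<in> J ` X" for x y
    using that by (auto intro!: banach_add[OF X] imageI simp flip: J_add)
  have diff_mem: "(\<lambda>j. x j - y j) \<in> J ` X" if "x \<in> J ` X" "y \<in> J ` X" for x y
    using that by (auto intro!: banach_diff[OF X] imageI simp flip: J_diff)
  have Q_scaleC: "Q (\<lambda>j. c *\<^sub>C y j) = cmod c * Q y" if y: "y \<in> J ` X" for c y
  proof (cases "c = 0")
    case True
    then show ?thesis
      using Q_scaleC_le[OF y, of 0] Q_nonneg[OF scaleC_mem[OF y, of 0]] by simp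
  next
    case False
    have "Q (\<lambda>j. inverse c *\<^sub>C c *\<^sub>C y j) \<le> cmod (inverse c) * Q (\<lambda>j. c *\<^sub>C y j)"
      by (rule Q_scaleC_le[OF scaleC_mem[OF y]])
    then have "cmod c * Q y \<le> Q (\<lambda>j. c *\<^sub>C y j)"
      using False by (simp add: scaleC_scaleC norm_inverse inverse_eq_divide norm_divide pos_le_divide_eq mult.commute)
    with Q_scaleC_le[OF y] show ?thesis by (simp add: order_antisym)
  qed
  have Q_triangle: "Q (\<lambda>j. x j + y j) \<le> Q x + Q y" if x: "x \<in> J ` X" and y: "y \<in> J ` X" for x y
  proof (rule field_le_epsilon)
    fix e :: real assume e: "0 < e"
    obtain f where f: "f \<in> X" "J f = x" "N f < Q x + e / 2"
      using lift[OF x, of "Q x + e / 2"] e by auto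
    obtain g where g: "g \<in> X" "J g = y" "N g < Q y + e / 2"
      using lift[OF y, of "Q y + e / 2"] e by auto
    have "Q (\<lambda>j. x j + y j) \<le> N (\<lambda>i. f i + g i)"
      using Q_le[OF banach_add[OF X f(1) g(1)]] J_add[OF f(1) g(1)] f g by simp
    also have "\<dots> \<le> N f + N g" by (rule banach_triangle[OF X f(1) g(1)])
    finally show "Q (\<lambda>j. x j + y j) \<le> Q x + Q y + e" using f g by simp
  qed
  have Q_eq_0: "y = (\<lambda>j. 0)" if y: "y \<in> J ` X" and Qy: "Q y = 0" for y
  proof -
    obtain f where f: "f \<in> X" "J f = y" using y by blast
    have "\<exists>g\<in>X. J g = y \<and> N g < (1/2) ^ m" for m :: nat
      using lift[OF y] Qy by simp
    then obtain g where g: "\<And>m::nat. g m \<in> X" "\<And>m. J (g m) = y" "\<And>m. N (g m) < (1/2) ^ m"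
      by metis
    define s where "s = (\<lambda>m i. f i - g m i)"
    have "J f = (\<lambda>j. 0)"
    proof (rule closed)
      show "s m \<in> X" "J (s m) = (\<lambda>j. 0)" for m
        using f g[of m] banach_diff[OF X] J_diff by (simp_all add: s_def)
      show "f \<in> X" by fact
      have "N (\<lambda>i. s m i - f i) = N (g m)" for m
        using banach_norm_scaleC[OF X g(1), of "- 1" m] by (simp add: s_def scaleC_minus_one)
      moreover have "(\<lambda>m. N (g m)) \<longlonglongrightarrow> 0"
      proof (rule tendsto_sandwich)
        show "(\<lambda>m. 0::real) \<longlonglongrightarrow> 0" by simp
        show "(\<lambda>m. (1/2::real) ^ m) \<longlonglongrightarrow> 0" by (rule LIMSEQ_realpow_zero) auto
      qed (use g banach_nonneg[OF X] in \<open>auto intro!: always_eventually simp: less_imp_le\<close>)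
      ultimately show "(\<lambda>m. N (\<lambda>i. s m i - f i)) \<longlonglongrightarrow> 0" by simp
    qed
    with f show ?thesis by simp
  qed
  have Q_zero: "Q (\<lambda>j. 0) = 0"
    using Q_le[OF banach_zero[OF X]] Q_nonneg[OF imageI[OF banach_zero[OF X]]]
    by (simp add: J_zero banach_norm_zero[OF X])
  have complete: "\<exists>y\<in>J ` X. (\<lambda>n. Q (\<lambda>j. s n j - y j)) \<longlonglongrightarrow> 0"
    if s: "\<And>m. s m \<in> J ` X"
      and cauchy: "\<And>e. 0 < e \<Longrightarrow> \<exists>M. \<forall>m\<ge>M. \<forall>n\<ge>M. Q (\<lambda>j. s m j - s n j) < e"
    for s :: "nat \<Rightarrow> 'j \<Rightarrow> 'v"
  proof -
    have "\<exists>M. \<forall>m\<ge>M. \<forall>n\<ge>M. Q (\<lambda>j. s m j - s n j) < (1/2) ^ k" for k :: nat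
      by (rule cauchy) simp
    then obtain M where M: "\<And>k m n. M k \<le> m \<Longrightarrow> M k \<le> n \<Longrightarrow> Q (\<lambda>j. s m j - s n j) < (1/2) ^ k"
      by metis
    \<comment> \<open>partial sums give a monotone sequence of indices above \<open>M\<close>\<close>
    define r where "r = (\<lambda>k. \<Sum>j\<le>k. M j)"
    have r_ge: "M k \<le> r k" for k
      unfolding r_def by (rule member_le_sum) auto
    have r_Suc: "r k \<le> r (Suc k)" for k by (simp add: r_def)
    have "\<exists>d\<in>X. J d = (\<lambda>j. s (r (Suc k)) j - s (r k) j) \<and> N d < (1/2) ^ k" for k
      using r_ge[of k] r_Suc[of k] by (intro lift diff_mem s M) auto
    then obtain d where d: "\<And>k. d k \<in> X" "\<And>k. J (d k) = (\<lambda>j. s (r (Suc k)) j - s (r k) j)"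
        "\<And>k. N (d k) < (1/2) ^ k"
      by metis
    obtain f0 where f0: "f0 \<in> X" "J f0 = s (r 0)" using s by (metis imageE)
    define f where "f = rec_nat f0 (\<lambda>k g i. g i + d k i)"
    have f_Suc: "f (Suc k) = (\<lambda>i. f k i + d k i)" for k by (simp add: f_def)
    have f: "f k \<in> X \<and> J (f k) = s (r k)" for k
    proof (induction k)
      case 0
      show ?case using f0 by (simp add: f_def)
    next
      case (Suc k)
      then show ?case
        using banach_add[OF X _ d(1)[of k]] J_add[OF _ d(1)[of k]] d(2)[of k] by (simp add: f_Suc)
    qed
    have "\<exists>x\<in>X. (\<lambda>n. N (\<lambda>i. f n i - x i)) \<longlonglongrightarrow> 0"
    proof (rule banach_complete_geometric[OF X])
      show "f m \<in> X" for m using f by blast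
      show "N (\<lambda>i. f (Suc m) i - f m i) \<le> (1/2) ^ m" for m
        using d(3)[of m] by (simp add: f_Suc)
    qed
    then obtain x where x: "x \<in> X" "(\<lambda>n. N (\<lambda>i. f n i - x i)) \<longlonglongrightarrow> 0" by blast
    \<comment> \<open>the subsequence \<open>s (r k)\<close> converges to \<open>J x\<close>, and the Cauchy condition carries this over to \<open>s\<close>\<close>
    have "(\<lambda>n. Q (\<lambda>j. s n j - J x j)) \<longlonglongrightarrow> 0"
    proof (rule LIMSEQ_I)
      fix e :: real assume e: "0 < e"
      obtain K where K: "\<And>n. K \<le> n \<Longrightarrow> norm (N (\<lambda>i. f n i - x i) - 0) < e / 2"
        using LIMSEQ_D[OF x(2), of "e / 2"] e by auto
      obtain L :: nat where L: "(1/2) ^ L < e / 2"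
        using real_arch_pow_inv[of "e / 2" "1/2"] e by auto
      define k where "k = max K L"
      have "(1/2::real) ^ k \<le> (1/2) ^ L"
        by (rule power_decreasing) (auto simp: k_def)
      with L have k: "(1/2::real) ^ k < e / 2" by linarith
      have Jx: "J x \<in> J ` X" using x by blast
      have "norm (Q (\<lambda>j. s m j - J x j) - 0) < e" if m: "M k \<le> m" for m
      proof -
        have "Q (\<lambda>j. s m j - J x j)
            = Q (\<lambda>j. (s m j - s (r k) j) + (s (r k) j - J x j))" by simp
        also have "\<dots> \<le> Q (\<lambda>j. s m j - s (r k) j) + Q (\<lambda>j. s (r k) j - J x j)"
          by (intro Q_triangle diff_mem s Jx)
        also have "Q (\<lambda>j. s m j - s (r k) j) < e / 2"
          using M[OF m r_ge] k by simp
        also have "Q (\<lambda>j. s (r k) j - J x j) < e / 2"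
          using Q_le[OF banach_diff[OF X _ x(1)], of "f k"] f[of k] J_diff[OF _ x(1), of "f k"]
            K[of k] by (simp add: k_def)
        finally show ?thesis using Q_nonneg[OF diff_mem[OF s Jx], of m] by simp
      qed
      then show "\<exists>no. \<forall>m\<ge>no. norm (Q (\<lambda>j. s m j - J x j) - 0) < e" by blast
    qed
    then show ?thesis using x by blast
  qed
  show ?thesis
    unfolding banach_space_on_def
  proof (intro conjI ballI allI impI)
    show "(\<lambda>i. 0) \<in> J ` X"
      using imageI[OF banach_zero[OF X], of J] by (simp add: J_zero)
    show "Q x = 0 \<longleftrightarrow> x = (\<lambda>i. 0)" if "x \<in> J ` X" for x
      using Q_eq_0[OF that] Q_zero by blast
    fix s :: "nat \<Rightarrow> 'j \<Rightarrow> 'v"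
    assume "range s \<subseteq> J ` X \<and>
        (\<forall>e>0. \<exists>M. \<forall>m\<ge>M. \<forall>n\<ge>M. Q (\<lambda>i. s m i - s n i) < e)"
    then show "\<exists>x\<in>J ` X. (\<lambda>n. Q (\<lambda>i. s n i - x i)) \<longlonglongrightarrow> 0"
      by (intro complete) auto
  qed (use Q_nonneg add_mem scaleC_mem Q_scaleC Q_triangle in auto)
qed

section \<open>Analytic vector-valued functions\<close>

lemma analytic_functions_iff:
  "f \<in> analytic_functions U \<longleftrightarrow>
    (\<forall>w. w \<notin> U \<longrightarrow> f w = 0) \<and> (\<forall>z\<in>U. \<exists>r>0. \<exists>a. expands_on z r f a)"
  by (simp add: analytic_functions_def expands_on_def)

lemma analytic_expands_on_taylor_coeff:
  assumes "f \<in> analytic_functions U" "z \<in> U"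
  obtains r where "0 < r" "expands_on z r f (\<lambda>i. taylor_coeff f i z)"
proof -
  obtain r a where ra: "0 < r" "expands_on z r f a"
    using assms by (auto simp: analytic_functions_iff)
  have "(\<lambda>i. taylor_coeff f i z) = a"
    using taylor_coeff_expands_on[OF ra(2,1)] by auto
  with ra that show thesis by blast
qed

lemma taylor_coeff_add:
  assumes "f \<in> analytic_functions U" "g \<in> analytic_functions U" "z \<in> U"
  shows "taylor_coeff (\<lambda>w. f w + g w) i z = taylor_coeff f i z + taylor_coeff g i z"
proof -
  obtain r where r: "0 < r" "expands_on z r f (\<lambda>i. taylor_coeff f i z)"
    using analytic_expands_on_taylor_coeff[OF assms(1,3)] .
  obtain s where s: "0 < s" "expands_on z s g (\<lambda>i. taylor_coeff g i z)"
    using analytic_expands_on_taylor_coeff[OF assms(2,3)] .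
  show ?thesis
    using expands_on_add[OF expands_on_subset[OF r(2)] expands_on_subset[OF s(2)], of "min r s"] r s
    by (intro taylor_coeff_expands_on[of _ "min r s"]) auto
qed

lemma taylor_coeff_scaleC:
  assumes "f \<in> analytic_functions U" "z \<in> U"
  shows "taylor_coeff (\<lambda>w. c *\<^sub>C f w) i z = c *\<^sub>C taylor_coeff f i z"
proof -
  obtain r where r: "0 < r" "expands_on z r f (\<lambda>i. taylor_coeff f i z)"
    using analytic_expands_on_taylor_coeff[OF assms] .
  show ?thesis
    using taylor_coeff_expands_on[OF expands_on_scaleC[OF r(2)] r(1)] .
qed

lemma product_expands_on:
  assumes p: "p holomorphic_on U" and U: "open U" and f: "f \<in> analytic_functions U" and z: "z \<in> U"
  obtains r where "0 < r" "expands_on z r (\<lambda>w. p w *\<^sub>C f w)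
    (fps_act (fps_expansion p z) (\<lambda>i. taylor_coeff f i z))"
proof -
  obtain s where s: "0 < s" "ball z s \<subseteq> U" using U z open_contains_ball by blast
  obtain r where r: "0 < r" "expands_on z r f (\<lambda>i. taylor_coeff f i z)"
    using analytic_expands_on_taylor_coeff[OF f z] .
  have "expands_on z s p (fps_nth (fps_expansion p z))"
    using p s by (intro holomorphic_expands_on) (rule holomorphic_on_subset)
  then have "expands_on z (min r s) (\<lambda>w. p w *\<^sub>C f w)
      (fps_act (fps_expansion p z) (\<lambda>i. taylor_coeff f i z))"
    using r(2) by (intro expands_on_scaleC_product) (rule expands_on_subset, assumption, simp)+
  then show thesis using that[of "min r s"] r s by simp
qed

lemma taylor_coeff_product:
  assumes "p holomorphic_on U" "open U" "f \<in> analytic_functions U" "z \<in> U"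
  shows "taylor_coeff (\<lambda>w. p w *\<^sub>C f w) i z
    = fps_act (fps_expansion p z) (\<lambda>i. taylor_coeff f i z) i"
proof -
  obtain r where "0 < r" "expands_on z r (\<lambda>w. p w *\<^sub>C f w)
      (fps_act (fps_expansion p z) (\<lambda>i. taylor_coeff f i z))"
    by (rule product_expands_on[OF assms])
  then show ?thesis by (intro taylor_coeff_expands_on)
qed

lemma analytic_functions_mult:
  assumes p: "p holomorphic_on U" and U: "open U" and f: "f \<in> analytic_functions U"
  shows "(\<lambda>w. p w *\<^sub>C f w) \<in> analytic_functions U"
  unfolding analytic_functions_iff
proof (intro conjI allI ballI impI)
  show "p w *\<^sub>C f w = 0" if "w \<notin> U" for w
    using f that by (simp add: analytic_functions_iff scaleC.zero_right)
  show "\<exists>r>0. \<exists>a. expands_on z r (\<lambda>w. p w *\<^sub>C f w) a" if "z \<in> U" for z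
    by (rule product_expands_on[OF assms that]) blast
qed

text \<open>
  Near \<open>z\<close> the expansion of \<open>f\<close> is shifted down by one; at other points \<open>f\<close> is multiplied by a
  holomorphic function. Since \<open>f = 0\<close> outside \<open>U\<close>, so is the quotient, and the factorization holds on
  the whole plane.
\<close>
lemma analytic_functions_divide_linear:
  assumes U: "open U" and f: "f \<in> analytic_functions U" and z: "z \<in> U" "f z = 0"
  obtains g where "g \<in> analytic_functions U" "\<And>w. f w = (w - z) *\<^sub>C g w"
proof
  define g where "g = (\<lambda>w. if w = z then taylor_coeff f 1 z else inverse (w - z) *\<^sub>C f w)"
  show "f w = (w - z) *\<^sub>C g w" for w
    using z by (simp add: g_def scaleC_scaleC scaleC.zero_left)
  show "g \<in> analytic_functions U"
    unfolding analytic_functions_iff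
  proof (intro conjI allI ballI impI)
    show "g w = 0" if "w \<notin> U" for w
      using f that z by (auto simp: analytic_functions_iff g_def scaleC.zero_right)
    fix x assume x: "x \<in> U"
    show "\<exists>r>0. \<exists>a. expands_on x r g a"
    proof (cases "x = z")
      case True
      obtain r where r: "0 < r" "expands_on z r f (\<lambda>i. taylor_coeff f i z)"
        using analytic_expands_on_taylor_coeff[OF f z(1)] .
      show ?thesis
        using expands_on_divide_linear[OF r(2) z(2) r(1)] r(1) True unfolding g_def by blast
    next
      case False
      obtain r where r: "0 < r" "expands_on x r f (\<lambda>i. taylor_coeff f i x)"
        using analytic_expands_on_taylor_coeff[OF f x] .
      define s where "s = min r (dist x z)"
      have s: "0 < s" using r False by (simp add: s_def)
      have "(\<lambda>w. inverse (w - z)) holomorphic_on ball x s"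
        by (intro holomorphic_intros) (auto simp: s_def)
      then have "expands_on x s (\<lambda>w. inverse (w - z) *\<^sub>C f w)
          (fps_act (fps_expansion (\<lambda>w. inverse (w - z)) x) (\<lambda>i. taylor_coeff f i x))"
        using r(2)
        by (intro expands_on_scaleC_product holomorphic_expands_on)
           (auto simp: s_def intro: expands_on_subset)
      then have "expands_on x s g
          (fps_act (fps_expansion (\<lambda>w. inverse (w - z)) x) (\<lambda>i. taylor_coeff f i x))"
        by (rule expands_on_cong) (auto simp: g_def s_def)
      with s show ?thesis by blast
    qed
  qed
qed

text \<open>Automorphisms of the disc move any point of it to \<open>0\<close>.\<close>
lemma conformal_equivalence_vanishing_at:
  assumes conf: "conformal_equivalence \<phi> U (ball 0 1)" and z: "z \<in> U"
  obtains \<psi> where "conformal_equivalence \<psi> U (ball 0 1)" "\<psi> z = 0"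
proof -
  have \<phi>: "\<phi> holomorphic_on U" "bij_betw \<phi> U (ball 0 1)" "inv_into U \<phi> holomorphic_on ball 0 1"
    using conf by (auto simp: conformal_equivalence_def)
  have "\<phi> z \<in> ball 0 1" using \<phi>(2) z bij_betwE by blast
  then obtain f g where fg: "f (\<phi> z) = 0" "f holomorphic_on ball 0 1" "f ` ball 0 1 \<subseteq> ball 0 1"
      "g holomorphic_on ball 0 1" "g ` ball 0 1 \<subseteq> ball 0 1"
      "\<And>w. w \<in> ball 0 1 \<Longrightarrow> f (g w) = w" "\<And>w. w \<in> ball 0 1 \<Longrightarrow> g (f w) = w"
    by (rule ball_biholomorphism_exists) blast
  have "bij_betw f (ball 0 1) (ball 0 1)"
    by (rule bij_betw_byWitness[where f' = g]) (use fg in auto)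
  with \<phi>(2) have bij: "bij_betw (f \<circ> \<phi>) U (ball 0 1)" by (rule bij_betw_trans)
  have inv: "inv_into U (f \<circ> \<phi>) w = inv_into U \<phi> (g w)" if "w \<in> ball 0 1" for w
  proof (rule inv_into_f_eq)
    have gw: "g w \<in> \<phi> ` U" using that fg(5) \<phi>(2) by (auto simp: bij_betw_def image_subset_iff)
    show "inj_on (f \<circ> \<phi>) U" using bij by (simp add: bij_betw_def)
    show "inv_into U \<phi> (g w) \<in> U" using gw by (rule inv_into_into)
    show "(f \<circ> \<phi>) (inv_into U \<phi> (g w)) = w"
      using f_inv_into_f[OF gw] fg(6)[OF that] by simp
  qed
  have "(inv_into U \<phi> \<circ> g) holomorphic_on ball 0 1"
    using fg(4,5) \<phi>(3) by (intro holomorphic_on_compose_gen)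
  then have "inv_into U (f \<circ> \<phi>) holomorphic_on ball 0 1"
    by (rule holomorphic_transform) (simp add: inv)
  moreover have "(f \<circ> \<phi>) holomorphic_on U"
    using \<phi>(1,2) fg(2) by (intro holomorphic_on_compose_gen) (auto simp: bij_betw_def)
  ultimately have "conformal_equivalence (f \<circ> \<phi>) U (ball 0 1)"
    using bij by (simp add: conformal_equivalence_def)
  then show thesis using that fg(1) by simp
qed

text \<open>
  An injective holomorphic function has a simple zero, so \<open>\<phi> w / (w - z)\<close> extends holomorphically
  across \<open>z\<close> without zeros on \<open>U\<close>; \<open>q\<close> is the reciprocal of this extension.
\<close>
lemma holomorphic_simple_zero_quotient:
  assumes U: "open U" and \<phi>: "\<phi> holomorphic_on U" "inj_on \<phi> U" and z: "z \<in> U" "\<phi> z = 0"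
  obtains q where "q holomorphic_on U" "\<And>w. w \<in> U \<Longrightarrow> \<phi> w * q w = w - z"
proof
  define p where "p = (\<lambda>w. if w = z then deriv \<phi> z else \<phi> w / (w - z) - \<phi> z / (w - z))"
  have p: "p holomorphic_on U"
    unfolding p_def by (rule pole_theorem_open[OF \<phi>(1) U]) auto
  have "deriv \<phi> z \<noteq> 0"
    using holomorphic_injective_imp_regular[OF \<phi>(1) U \<phi>(2) z(1)] .
  moreover have "\<phi> w \<noteq> 0" if "w \<in> U" "w \<noteq> z" for w
    using inj_onD[OF \<phi>(2), of w z] that z by auto
  ultimately have p0: "p w \<noteq> 0" if "w \<in> U" for w
    using that z by (auto simp: p_def)
  show "(\<lambda>w. inverse (p w)) holomorphic_on U"
    using p p0 by (intro holomorphic_intros) auto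
  show "\<phi> w * inverse (p w) = w - z" if "w \<in> U" for w
    using p0[OF that] z by (auto simp: p_def divide_simps)
qed

section \<open>Division and multiplication in admissible spaces\<close>

locale admissible_with_uniformizer =
  fixes U :: "complex set" and \<F> :: "(complex \<Rightarrow> 'w::complex_banach) set"
    and N :: "(complex \<Rightarrow> 'w) \<Rightarrow> real" and z :: complex and \<phi> :: "complex \<Rightarrow> complex"
  assumes open_U: "open U" and admissible: "admissible U \<F> N" and z_in_U: "z \<in> U"
    and conformal: "conformal_equivalence \<phi> U (ball 0 1)" and vanish: "\<phi> z = 0"
begin

abbreviation taylor :: "(complex \<Rightarrow> 'w) \<Rightarrow> nat \<Rightarrow> 'w"
  where "taylor f \<equiv> \<lambda>i. taylor_coeff f i z"

lemma \<phi>_holomorphic: "\<phi> holomorphic_on U" and \<phi>_inj: "inj_on \<phi> U"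
  using conformal by (auto simp: conformal_equivalence_def bij_betw_def)

lemma banach: "banach_space_on \<F> N"
  using admissible by (simp add: admissible_def)

lemma analytic: "f \<in> \<F> \<Longrightarrow> f \<in> analytic_functions U"
  using admissible[unfolded admissible_def, THEN conjunct2, THEN conjunct1] by (rule subsetD)

lemmas admissible_\<phi> = admissible[unfolded admissible_def, THEN conjunct2, THEN conjunct2,
  THEN conjunct2, THEN spec, THEN mp, OF conformal, THEN bspec]

lemma mult_\<phi>_mem_iff:
  "f \<in> analytic_functions U \<Longrightarrow> (\<lambda>w. \<phi> w *\<^sub>C f w) \<in> \<F> \<longleftrightarrow> f \<in> \<F>"
  by (rule sym) (rule admissible_\<phi>[THEN conjunct1])

lemma norm_mult_\<phi>: "f \<in> \<F> \<Longrightarrow> N (\<lambda>w. \<phi> w *\<^sub>C f w) = N f"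
  using admissible_\<phi>[OF analytic, THEN conjunct2] by (rule mp)

lemma taylor_mult_\<phi>: "f \<in> \<F> \<Longrightarrow> taylor (\<lambda>w. \<phi> w *\<^sub>C f w) i = fps_act (fps_expansion \<phi> z) (taylor f) i"
  by (rule taylor_coeff_product[OF \<phi>_holomorphic open_U analytic z_in_U])

lemma taylor_add: "f \<in> \<F> \<Longrightarrow> g \<in> \<F> \<Longrightarrow> taylor (\<lambda>w. f w + g w) i = taylor f i + taylor g i"
  by (rule taylor_coeff_add[OF analytic analytic z_in_U])

lemma taylor_scaleC: "f \<in> \<F> \<Longrightarrow> taylor (\<lambda>w. c *\<^sub>C f w) i = c *\<^sub>C taylor f i"
  by (rule taylor_coeff_scaleC[OF analytic z_in_U])

lemma fps_expansion_\<phi>: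
  obtains u where "fps_expansion \<phi> z = fps_X * u" "fps_nth u 0 \<noteq> 0"
proof
  show "fps_expansion \<phi> z = fps_X * fps_shift 1 (fps_expansion \<phi> z)"
    by (rule fps_ext) (auto simp: fps_expansion_def vanish)
  show "fps_nth (fps_shift 1 (fps_expansion \<phi> z)) 0 \<noteq> 0"
    using holomorphic_injective_imp_regular[OF \<phi>_holomorphic open_U \<phi>_inj z_in_U]
    by (simp add: fps_expansion_def)
qed

text \<open>
  With \<open>f w = (w - z) g w\<close> and \<open>w - z = \<phi> w * q w\<close>, the quotient is \<open>q g\<close>, which is analytic; then
  admissibility puts it into \<open>\<F>\<close>.
\<close>
lemma divide_by_\<phi>:
  assumes f: "f \<in> \<F>" and "f z = 0"
  obtains h where "h \<in> \<F>" "f = (\<lambda>w. \<phi> w *\<^sub>C h w)"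
proof -
  obtain g where g: "g \<in> analytic_functions U" "\<And>w. f w = (w - z) *\<^sub>C g w"
    using analytic_functions_divide_linear[OF open_U analytic[OF f] z_in_U assms(2)] by blast
  obtain q where q: "q holomorphic_on U" "\<And>w. w \<in> U \<Longrightarrow> \<phi> w * q w = w - z"
    using holomorphic_simple_zero_quotient[OF open_U \<phi>_holomorphic \<phi>_inj z_in_U vanish] by blast
  define h where "h = (\<lambda>w. q w *\<^sub>C g w)"
  have h: "h \<in> analytic_functions U"
    unfolding h_def by (rule analytic_functions_mult[OF q(1) open_U g(1)])
  have fh: "f = (\<lambda>w. \<phi> w *\<^sub>C h w)"
  proof
    fix w show "f w = \<phi> w *\<^sub>C h w"
    proof (cases "w \<in> U")
      case True
      with g q show ?thesis by (simp add: h_def scaleC_scaleC)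
    next
      case False
      then show ?thesis
        using h analytic[OF f] by (simp add: analytic_functions_iff scaleC.zero_right)
    qed
  qed
  then have "h \<in> \<F>" using f mult_\<phi>_mem_iff[OF h] by simp
  then show thesis using that fh by blast
qed

text \<open>
  Coefficientwise, \<open>\<phi>\<close> is \<open>X u\<close> with \<open>u\<close> invertible: the factor \<open>X\<close> shifts by one and \<open>u\<close> preserves the
  vanishing of initial coefficients.
\<close>
lemma taylor_of_quotient_vanish:
  assumes "h \<in> \<F>" "\<And>i. i < Suc k \<Longrightarrow> taylor (\<lambda>w. \<phi> w *\<^sub>C h w) i = 0" and "i < k"
  shows "taylor h i = 0"
proof -
  obtain u where u: "fps_expansion \<phi> z = fps_X * u" "fps_nth u 0 \<noteq> 0"
    by (rule fps_expansion_\<phi>)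
  have *: "fps_act u (taylor h) i = 0" if "i < k" for i
    using assms(2)[of "Suc i"] that
    by (simp add: taylor_mult_\<phi>[OF assms(1)] u(1) fps_act_mult fps_act_X_Suc)
  have "taylor h i = fps_act (inverse u * u) (taylor h) i"
    using u(2) fps_act_const[of 1 "taylor h"] by (simp add: inverse_mult_eq_1)
  also have "\<dots> = fps_act (inverse u) (fps_act u (taylor h)) i"
    by (simp add: fps_act_mult)
  also have "\<dots> = 0"
    unfolding fps_act_def[of "inverse u"] using * assms(3) by (simp add: scaleC.zero_right)
  finally show ?thesis .
qed

lemma divide_by_\<phi>_power:
  assumes "f \<in> \<F>" "\<And>i. i < k \<Longrightarrow> taylor f i = 0"
  obtains h where "h \<in> \<F>" "\<And>i. taylor f i = fps_act (fps_expansion \<phi> z ^ k) (taylor h) i"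
  using assms
proof (induction k arbitrary: f thesis)
  case 0
  show ?case by (rule 0(1)[OF 0(2)]) (simp add: fps_act_const[of 1, simplified])
next
  case (Suc k)
  have "f z = 0" using Suc.prems(3)[of 0] by (simp add: taylor_coeff_def)
  then obtain g where g: "g \<in> \<F>" "f = (\<lambda>w. \<phi> w *\<^sub>C g w)"
    using divide_by_\<phi>[OF Suc.prems(2)] by blast
  have "taylor g i = 0" if "i < k" for i
    using Suc.prems(3) that unfolding g(2) by (rule taylor_of_quotient_vanish[OF g(1)])
  then obtain h where h: "h \<in> \<F>" "\<And>i. taylor g i = fps_act (fps_expansion \<phi> z ^ k) (taylor h) i"
    using Suc.IH[OF _ g(1)] by blast
  show ?case
    by (rule Suc.prems(1)[OF h(1)])
       (simp add: g(2) taylor_mult_\<phi>[OF g(1)] h(2) fps_act_mult)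
qed

text \<open>
  Expanding \<open>c\<close> in powers of \<open>\<phi>\<close> one term at a time: \<open>c = c\<^sub>0 + \<phi> d\<close> for a power series \<open>d\<close>, and because
  \<open>\<phi>\<close> vanishes at \<open>z\<close> the first \<open>n\<close> coefficients of \<open>d f\<close> determine the first \<open>n + 1\<close> of \<open>\<phi> d f\<close>. So if
  \<open>g \<in> \<F>\<close> realizes \<open>d f\<close> to order \<open>n\<close>, then \<open>c\<^sub>0 f + \<phi> g\<close> realizes \<open>c f\<close> to order \<open>n + 1\<close>. The constant
  grows by \<open>|c\<^sub>0|\<close>, multiplication by \<open>\<phi>\<close> being isometric.
\<close>
lemma jet_multiplier:
  "\<exists>C. \<forall>f\<in>\<F>. \<exists>g\<in>\<F>. N g \<le> C * N f \<and> (\<forall>i<n. taylor g i = fps_act c (taylor f) i)"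
proof (induction n arbitrary: c)
  case 0
  show ?case
  proof (intro exI[of _ 1] ballI)
    fix f assume "f \<in> \<F>"
    then show "\<exists>g\<in>\<F>. N g \<le> 1 * N f \<and> (\<forall>i<0. taylor g i = fps_act c (taylor f) i)"
      by (intro bexI[of _ f]) simp_all
  qed
next
  case (Suc n)
  obtain u where u: "fps_expansion \<phi> z = fps_X * u" "fps_nth u 0 \<noteq> 0"
    by (rule fps_expansion_\<phi>)
  define d where "d = inverse u * fps_shift 1 c"
  have "c = fps_const (fps_nth c 0) + fps_X * fps_shift 1 c"
    by (rule fps_ext) auto
  also have "fps_X * fps_shift 1 c = fps_X * (u * inverse u) * fps_shift 1 c"
    by (simp only: inverse_mult_eq_1'[OF u(2)] mult_1_right)
  also have "\<dots> = fps_expansion \<phi> z * d"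
    by (simp only: u(1) d_def mult.assoc)
  finally have c: "c = fps_const (fps_nth c 0) + fps_expansion \<phi> z * d" .
  obtain C where C: "\<And>f. f \<in> \<F> \<Longrightarrow>
      \<exists>g\<in>\<F>. N g \<le> C * N f \<and> (\<forall>i<n. taylor g i = fps_act d (taylor f) i)"
    using Suc.IH by blast
  show ?case
  proof (intro exI[of _ "cmod (fps_nth c 0) + C"] ballI)
    fix f assume f: "f \<in> \<F>"
    obtain g where g: "g \<in> \<F>" "N g \<le> C * N f" "\<And>i. i < n \<Longrightarrow> taylor g i = fps_act d (taylor f) i"
      using C[OF f] by blast
    have \<phi>g: "(\<lambda>w. \<phi> w *\<^sub>C g w) \<in> \<F>" using mult_\<phi>_mem_iff[OF analytic[OF g(1)]] g(1) by simp
    have cf: "(\<lambda>w. fps_nth c 0 *\<^sub>C f w) \<in> \<F>" using banach_scaleC[OF banach f] .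
    let ?h = "\<lambda>w. fps_nth c 0 *\<^sub>C f w + \<phi> w *\<^sub>C g w"
    have "N ?h \<le> (cmod (fps_nth c 0) + C) * N f"
      using banach_triangle[OF banach cf \<phi>g] banach_norm_scaleC[OF banach f] norm_mult_\<phi>[OF g(1)] g(2)
      by (simp add: distrib_right)
    moreover have "taylor ?h i = fps_act c (taylor f) i" if "i < Suc n" for i
    proof -
      have "fps_act (fps_expansion \<phi> z) (taylor g) i
          = fps_act (fps_expansion \<phi> z) (fps_act d (taylor f)) i"
      proof (cases i)
        case 0
        then show ?thesis by (simp add: fps_act_def fps_expansion_def vanish scaleC.zero_left)
      next
        case (Suc j)
        have "fps_act u (taylor g) j = fps_act u (fps_act d (taylor f)) j"
          using g(3) Suc that by (intro fps_act_cong) auto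
        then show ?thesis
          by (simp add: u(1) fps_act_mult Suc fps_act_X_Suc)
      qed
      then have "taylor ?h i = fps_nth c 0 *\<^sub>C taylor f i + fps_act (fps_expansion \<phi> z * d) (taylor f) i"
        by (simp add: taylor_add[OF cf \<phi>g] taylor_scaleC[OF f]
            taylor_mult_\<phi>[OF g(1)] fps_act_mult)
      also have "\<dots> = fps_act (fps_const (fps_nth c 0) + fps_expansion \<phi> z * d) (taylor f) i"
        by (simp only: fps_act_add_left fps_act_const)
      also have "\<dots> = fps_act c (taylor f) i"
        by (simp only: c[symmetric])
      finally show ?thesis .
    qed
    ultimately show "\<exists>g\<in>\<F>. N g \<le> (cmod (fps_nth c 0) + C) * N f \<and>
        (\<forall>i<Suc n. taylor g i = fps_act c (taylor f) i)"
      using banach_add[OF banach cf \<phi>g] by blast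
  qed
qed

text \<open>
  Admissibility bounds evaluation at \<open>z\<close> for functions only, so higher coefficients are reached by
  induction: \<open>f\<close> vanishes at \<open>z\<close> because \<open>\<delta>\<^sub>z\<close> is bounded, and after dividing the sequence and its
  limit by \<open>\<phi>\<close>, which preserves norms, the order of vanishing in question has dropped by one.
\<close>
lemma vanishing_order_closed:
  fixes s :: "nat \<Rightarrow> complex \<Rightarrow> 'w"
  assumes "\<And>m. s m \<in> \<F>" "\<And>m i. i < n \<Longrightarrow> taylor (s m) i = 0" "f \<in> \<F>"
    and "(\<lambda>m. N (\<lambda>w. s m w - f w)) \<longlonglongrightarrow> 0" and "i < n"
  shows "taylor f i = 0"
  using assms
proof (induction n arbitrary: s f i)
  case 0
  then show ?case by simp
next
  case (Suc n)
  have sz: "s m z = 0" for m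
    using Suc.prems(2)[of 0 m] by (simp add: taylor_coeff_def)
  obtain C where C: "\<And>f. f \<in> \<F> \<Longrightarrow> norm (f z) \<le> C * N f"
    using bspec[OF admissible[unfolded admissible_def, THEN conjunct2, THEN conjunct2, THEN conjunct1] z_in_U]
    by blast
  have "norm (f z) \<le> C * N (\<lambda>w. s m w - f w)" for m
    using C[OF banach_diff[OF banach Suc.prems(1,3)], of m] by (simp add: sz)
  moreover have "(\<lambda>m. C * N (\<lambda>w. s m w - f w)) \<longlonglongrightarrow> 0"
    using tendsto_mult_right_zero[OF Suc.prems(4)] .
  ultimately have fz: "f z = 0"
    using LIMSEQ_le_const[of _ 0 "norm (f z)"] by auto
  obtain h where h: "h \<in> \<F>" "f = (\<lambda>w. \<phi> w *\<^sub>C h w)"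
    using divide_by_\<phi>[OF Suc.prems(3) fz] by blast
  have "\<exists>t\<in>\<F>. s m = (\<lambda>w. \<phi> w *\<^sub>C t w)" for m
    using divide_by_\<phi>[OF Suc.prems(1) sz] by blast
  then obtain t where t: "\<And>m. t m \<in> \<F>" "\<And>m. s m = (\<lambda>w. \<phi> w *\<^sub>C t m w)" by metis
  have "taylor (t m) i = 0" if "i < n" for m i
    using Suc.prems(2)[of _ m] that unfolding t(2) by (rule taylor_of_quotient_vanish[OF t(1)])
  moreover have "(\<lambda>m. N (\<lambda>w. t m w - h w)) \<longlonglongrightarrow> 0"
    using Suc.prems(4) norm_mult_\<phi>[OF banach_diff[OF banach t(1) h(1)]]
    by (simp add: t(2) h(2) scaleC.diff_right)
  ultimately have ih: "taylor h j = 0" if "j < n" for j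
    using that by (intro Suc.IH[OF t(1) _ h(1)])
  show ?case
  proof (cases i)
    case 0
    then show ?thesis using fz by (simp add: taylor_coeff_def)
  next
    case (Suc j)
    obtain u where u: "fps_expansion \<phi> z = fps_X * u" by (rule fps_expansion_\<phi>)
    have "taylor f i = fps_act u (taylor h) j"
      by (simp add: h(2) taylor_mult_\<phi>[OF h(1)] u fps_act_mult Suc fps_act_X_Suc)
    also have "\<dots> = 0"
      using ih Suc.prems(5) Suc by (simp add: fps_act_def scaleC.zero_right)
    finally show ?thesis .
  qed
qed

section \<open>Jet spaces and the exact sequence\<close>

definition jet :: "nat \<Rightarrow> (complex \<Rightarrow> 'w) \<Rightarrow> nat \<Rightarrow> 'w"
  where "jet n f = (\<lambda>i. if i < n then taylor f i else 0)"

lemma jet_space_eq: "jet_space \<F> z n = jet n ` \<F>"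
proof (intro set_eqI iffI)
  fix x assume "x \<in> jet_space \<F> z n"
  then obtain f where "f \<in> \<F>" "x \<in> tuples n" "\<And>i. i < n \<Longrightarrow> x i = taylor f i"
    by (auto simp: jet_space_def)
  then show "x \<in> jet n ` \<F>"
    by (intro image_eqI[of _ _ f]) (auto simp: jet_def tuples_def)
qed (auto simp: jet_space_def jet_def tuples_def)

lemma jet_eq_iff: "x \<in> tuples n \<Longrightarrow> jet n f = x \<longleftrightarrow> (\<forall>i<n. x i = taylor f i)"
  by (auto simp: jet_def tuples_def fun_eq_iff not_less)

lemma jet_space_tuples: "x \<in> jet_space \<F> z n \<Longrightarrow> x \<in> tuples n"
  by (simp add: jet_space_def)

lemma banach_jet_space: "banach_space_on (jet_space \<F> z n) (jet_norm \<F> N z n)"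
  unfolding jet_space_eq
proof (rule quotient_banach_space_on[OF banach])
  show "jet n (\<lambda>w. f w + g w) = (\<lambda>i. jet n f i + jet n g i)" if "f \<in> \<F>" "g \<in> \<F>" for f g
    using taylor_add[OF that] by (auto simp: jet_def)
  show "jet n (\<lambda>w. c *\<^sub>C f w) = (\<lambda>i. c *\<^sub>C jet n f i)" if "f \<in> \<F>" for c f
    using taylor_scaleC[OF that] by (auto simp: jet_def scaleC.zero_right)
  show "jet_norm \<F> N z n y = (INF f\<in>{f\<in>\<F>. jet n f = y}. N f)" if "y \<in> jet n ` \<F>" for y
    using that jet_space_tuples[of y n] by (simp add: jet_norm_def jet_eq_iff flip: jet_space_eq)
  fix s :: "nat \<Rightarrow> complex \<Rightarrow> 'w" and f
  assume *: "\<And>m. s m \<in> \<F>" "\<And>m. jet n (s m) = (\<lambda>i. 0)" "f \<in> \<F>"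
    "(\<lambda>m. N (\<lambda>w. s m w - f w)) \<longlonglongrightarrow> 0"
  have "taylor (s m) i = 0" if "i < n" for m i
    using fun_cong[OF *(2), of m i] that by (simp add: jet_def)
  then have "taylor f i = 0" if "i < n" for i
    using that by (intro vanishing_order_closed[OF *(1) _ *(3,4)])
  then show "jet n f = (\<lambda>i. 0)" by (auto simp: jet_def)
qed

lemma jet_norm_le:
  assumes "f \<in> \<F>" "\<And>i. i < n \<Longrightarrow> x i = taylor f i"
  shows "jet_norm \<F> N z n x \<le> N f"
  unfolding jet_norm_def
  by (rule cINF_lower) (use assms banach_nonneg[OF banach] in \<open>auto intro!: bdd_belowI2\<close>)

lemma jet_norm_greatest:
  assumes "x \<in> jet_space \<F> z n"
    and "\<And>f. f \<in> \<F> \<Longrightarrow> (\<And>i. i < n \<Longrightarrow> x i = taylor f i) \<Longrightarrow> b \<le> N f"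
  shows "b \<le> jet_norm \<F> N z n x"
  unfolding jet_norm_def
  by (rule cINF_greatest) (use assms in \<open>auto simp: jet_space_def\<close>)

lemma tuple_inj_eq_taylor:
  assumes "x \<in> tuples n" "\<And>i. i < n \<Longrightarrow> x i = taylor f i"
    and "\<And>i. i < n + k \<Longrightarrow> taylor g i = fps_act (fps_X ^ k) (taylor f) i" and "i < n + k"
  shows "tuple_inj n (n + k) x i = taylor g i"
  using assms by (auto simp: tuple_inj_def fps_act_X_power)

text \<open>
  Moving entries up by \<open>k\<close> positions is multiplication of the jet by \<open>(w - z)\<^sup>k\<close>. The bound for a single
  representing function passes to the infimum over all of them.
\<close>
lemma bounded_tuple_inj:
  "bounded_operator_on (jet_space \<F> z n) (jet_norm \<F> N z n)
    (jet_space \<F> z (n + k)) (jet_norm \<F> N z (n + k)) (tuple_inj n (n + k))"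
proof -
  obtain C where C: "\<And>f. f \<in> \<F> \<Longrightarrow> \<exists>g\<in>\<F>. N g \<le> C * N f \<and>
      (\<forall>i<n + k. taylor g i = fps_act (fps_X ^ k) (taylor f) i)"
    using jet_multiplier[of "n + k" "fps_X ^ k"] by blast
  \<comment> \<open>a positive constant, so that it can be divided by\<close>
  define D where "D = max C 1"
  have lift: "\<exists>g\<in>\<F>. N g \<le> D * N f \<and> (\<forall>i<n + k. tuple_inj n (n + k) x i = taylor g i)"
    if f: "f \<in> \<F>" and x: "x \<in> tuples n" "\<And>i. i < n \<Longrightarrow> x i = taylor f i" for f x
  proof -
    obtain g where g: "g \<in> \<F>" "N g \<le> C * N f"
        "\<And>i. i < n + k \<Longrightarrow> taylor g i = fps_act (fps_X ^ k) (taylor f) i"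
      using C[OF f] by blast
    have "C * N f \<le> D * N f"
      using banach_nonneg[OF banach f] by (intro mult_right_mono) (auto simp: D_def)
    then show ?thesis
      using g tuple_inj_eq_taylor[OF x g(3)] by (intro bexI[OF _ g(1)]) auto
  qed
  show ?thesis
    unfolding bounded_operator_on_def
  proof (intro conjI ballI allI exI[of _ D])
    fix x assume x: "x \<in> jet_space \<F> z n"
    obtain f where f: "f \<in> \<F>" "\<And>i. i < n \<Longrightarrow> x i = taylor f i"
      using x by (auto simp: jet_space_def)
    obtain g where g: "g \<in> \<F>" "\<And>i. i < n + k \<Longrightarrow> tuple_inj n (n + k) x i = taylor g i"
      using lift[OF f(1) jet_space_tuples[OF x] f(2)] by blast
    have "tuple_inj n (n + k) x \<in> tuples (n + k)"
      using jet_space_tuples[OF x] by (auto simp: tuples_def tuple_inj_def)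
    with g show "tuple_inj n (n + k) x \<in> jet_space \<F> z (n + k)"
      by (auto simp: jet_space_def)
    have D: "0 < D" by (simp add: D_def)
    have "jet_norm \<F> N z (n + k) (tuple_inj n (n + k) x) / D \<le> jet_norm \<F> N z n x"
    proof (rule jet_norm_greatest[OF x])
      fix f assume f: "f \<in> \<F>" "\<And>i. i < n \<Longrightarrow> x i = taylor f i"
      obtain g where g: "g \<in> \<F>" "N g \<le> D * N f"
          "\<And>i. i < n + k \<Longrightarrow> tuple_inj n (n + k) x i = taylor g i"
        using lift[OF f(1) jet_space_tuples[OF x] f(2)] by blast
      have "jet_norm \<F> N z (n + k) (tuple_inj n (n + k) x) \<le> N g"
        by (rule jet_norm_le[OF g(1,3)])
      with g(2) D show "jet_norm \<F> N z (n + k) (tuple_inj n (n + k) x) / D \<le> N f"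
        by (simp add: divide_le_eq mult.commute)
    qed
    with D show "jet_norm \<F> N z (n + k) (tuple_inj n (n + k) x) \<le> D * jet_norm \<F> N z n x"
      by (simp add: divide_le_eq mult.commute)
  qed (auto simp: tuple_inj_def scaleC.zero_right)
qed

lemma tuple_proj_jet: "tuple_proj k (jet (n + k) f) = jet k f"
  by (auto simp: tuple_proj_def jet_def)

lemma bounded_tuple_proj:
  "bounded_operator_on (jet_space \<F> z (n + k)) (jet_norm \<F> N z (n + k))
    (jet_space \<F> z k) (jet_norm \<F> N z k) (tuple_proj k)"
  unfolding bounded_operator_on_def
proof (intro conjI ballI allI exI[of _ 1])
  fix x assume x: "x \<in> jet_space \<F> z (n + k)"
  then show "tuple_proj k x \<in> jet_space \<F> z k"
    by (auto simp: jet_space_eq tuple_proj_jet)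
  show "jet_norm \<F> N z k (tuple_proj k x) \<le> 1 * jet_norm \<F> N z (n + k) x"
    unfolding mult_1
    by (rule jet_norm_greatest[OF x], rule jet_norm_le) (auto simp: tuple_proj_def)
qed (auto simp: tuple_proj_def scaleC.zero_right)

text \<open>
  The representing function is \<open>\<phi>\<^sup>k h = (w - z)\<^sup>k u\<^sup>k h\<close>. Here \<open>u\<^sup>k h\<close> need not be a member of \<open>\<F>\<close>, but
  some \<open>g \<in> \<F>\<close> has the same \<open>n\<close>-jet.
\<close>
lemma kernel_tuple_proj:
  assumes y: "y \<in> jet_space \<F> z (n + k)" and "tuple_proj k y = (\<lambda>i. 0)"
  shows "y \<in> tuple_inj n (n + k) ` jet_space \<F> z n"
proof -
  obtain f where f: "f \<in> \<F>" "y = jet (n + k) f" using y by (auto simp: jet_space_eq)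
  have "taylor f i = 0" if "i < k" for i
    using fun_cong[OF assms(2), of i] that by (simp add: f(2) jet_def tuple_proj_def)
  then obtain h where h: "h \<in> \<F>" "\<And>i. taylor f i = fps_act (fps_expansion \<phi> z ^ k) (taylor h) i"
    using divide_by_\<phi>_power[OF f(1)] by blast
  obtain u where u: "fps_expansion \<phi> z = fps_X * u" by (rule fps_expansion_\<phi>)
  obtain g where g: "g \<in> \<F>" "\<And>i. i < n \<Longrightarrow> taylor g i = fps_act (u ^ k) (taylor h) i"
    using jet_multiplier[of n "u ^ k"] h(1) by blast
  have "taylor f i = (if i < k then 0 else fps_act (u ^ k) (taylor h) (i - k))" for i
    unfolding h(2) by (simp add: u power_mult_distrib fps_act_mult fps_act_X_power)
  then have "y = tuple_inj n (n + k) (jet n g)"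
    using g(2) by (auto simp: f(2) jet_def tuple_inj_def fun_eq_iff)
  with g(1) show ?thesis by (auto simp: jet_space_eq)
qed

lemma tuple_proj_tuple_inj: "tuple_proj k (tuple_inj n (n + k) x) = (\<lambda>i. 0)"
  by (auto simp: tuple_proj_def tuple_inj_def)

lemma tuple_inj_eq_0:
  assumes "tuple_inj n (n + k) x = (\<lambda>i. 0)"
  shows "x = (\<lambda>i. 0)"
proof
  fix i show "x i = 0" using fun_cong[OF assms, of "i + k"] by (simp add: tuple_inj_def)
qed

lemma short_exact:
  "short_exact_sequence
    (jet_space \<F> z n) (jet_norm \<F> N z n) (tuple_inj n (n + k))
    (jet_space \<F> z (n + k)) (jet_norm \<F> N z (n + k)) (tuple_proj k)
    (jet_space \<F> z k) (jet_norm \<F> N z k)"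
proof -
  have inj0: "tuple_inj n (n + k) (\<lambda>i. 0) = (\<lambda>i. 0 :: 'w)"
    by (auto simp: tuple_inj_def)
  have "exact_at {\<lambda>i::nat. 0::'w} (\<lambda>x. x) (jet_space \<F> z n) (tuple_inj n (n + k))"
    using tuple_inj_eq_0[of n k] banach_zero[OF banach_jet_space[of n]] inj0
    by (auto simp: exact_at_def)
  moreover have "exact_at (jet_space \<F> z n) (tuple_inj n (n + k)) (jet_space \<F> z (n + k)) (tuple_proj k)"
    using kernel_tuple_proj[of _ n k] tuple_proj_tuple_inj bounded_tuple_inj[of n k]
    by (auto simp: exact_at_def bounded_operator_on_def)
  moreover have "exact_at (jet_space \<F> z (n + k)) (tuple_proj k) (jet_space \<F> z k) (\<lambda>z. \<lambda>k::nat. 0::'w)"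
    by (simp add: exact_at_def jet_space_eq image_image tuple_proj_jet)
  ultimately show ?thesis
    using banach_jet_space bounded_tuple_inj bounded_tuple_proj
    by (simp add: short_exact_sequence_def)
qed

end

theorem theorem1:
  fixes U :: "complex set" and z :: complex
    and \<F> :: "(complex \<Rightarrow> 'w::complex_banach) set" and N :: "(complex \<Rightarrow> 'w) \<Rightarrow> real"
    and n k :: nat
  assumes "open U" and "\<exists>\<phi>. conformal_equivalence \<phi> U (ball 0 1)"
    and "admissible U \<F> N" and "z \<in> U" and "n \<ge> 1" and "k \<ge> 1"
  shows "short_exact_sequence
    (jet_space \<F> z n) (jet_norm \<F> N z n) (tuple_inj n (n + k))
    (jet_space \<F> z (n + k)) (jet_norm \<F> N z (n + k)) (tuple_proj k)
    (jet_space \<F> z k) (jet_norm \<F> N z k)"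
proof -
  obtain \<psi> where "conformal_equivalence \<psi> U (ball 0 1)" using assms(2) ..
  then obtain \<phi> where "conformal_equivalence \<phi> U (ball 0 1)" "\<phi> z = 0"
    using assms(4) by (rule conformal_equivalence_vanishing_at)
  then interpret admissible_with_uniformizer U \<F> N z \<phi>
    using assms by unfold_locales
  show ?thesis by (rule short_exact)
qed

end
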